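(* (Aromatic Noether theorem.) Let $\gamma\in\Omega_0$ be an aromatic Lagrangian and let $\tau\in\Omega_1$ be an aromatic vector field. Then $\tau$ is a divergence symmetry of $\gamma$ if and only if $\tau$ is the generator of a conservation law for $\delta_V\gamma$; that is, there exists $\eta\in\Omega_1$ with $\mathcal{L}_\tau\gamma=d_H\eta$ if and only if there exists $\eta'\in\Omega_1$ with $i_\tau(\delta_V\gamma)=d_H\eta'$.
   Context: Aromatic forests. Consider finite directed graphs with node set $V=V^\bullet\sqcup V^\circ$ (vertices $V^\bullet$, covertices $V^\circ$) and oriented edges $E\subset V\times V$ (loops allowed). Covertices are numbered $1,\dots,p$; vertices are indistinguishable. Each node is the source of exactly one edge, except $n$ nodes (the roots), which have no outgoing edge and are numbered $1,\dots,n$ (the $n$-th root is written $r_n$). A connected component has either exactly one root (a tree) or no root (an aroma). Such graphs, up to isomorphism preserving vertices/covertices and the numberings of covertices and roots, are called aromatic forests; $\mathcal{F}_{n,p}$ is the set of those with $n$ roots and $p$ covertices, and $\mathcal{F}_n=\mathcal{F}_{n,0}$. A predecessor of $u$ is a node $v$ with $(v,u)\in E$. $\mathrm{Span}$ denotes the real span. Aromatic forms. For $\gamma\in\mathcal{F}_{n,p}$ let $\wedge^\bullet\gamma=\frac{1}{n!}\sum_{\sigma\in S_n}\varepsilon(\sigma)\,\sigma\gamma$ with $\sigma$ permuting the root numbering, $\wedge^\circ\gamma=\frac1{p!}\sum_{\sigma\in S_p}\varepsilon(\sigma)\,\sigma\gamma$ with $\sigma$ permuting the covertex numbering ($\varepsilon$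 is the signature), and $\wedge=\wedge^\bullet\wedge^\circ$, extended linearly. Set $\Omega_{n,p}=\wedge\,\mathrm{Span}(\mathcal{F}_{n,p})$ and $\Omega_n=\Omega_{n,0}$; thus $\Omega_1=\mathrm{Span}(\mathcal{F}_1)$ (aromatic vector fields), $\Omega_0=\mathrm{Span}(\mathcal{F}_0)$ (aromatic Lagrangians). Derivatives. For a root $r$ and a node $u$ of $\gamma$ (possibly $u=r$), $D^{r\to u}\gamma$ is $\gamma$ with the edge $(r,u)$ added (so $r$ is no longer a root), and $D^r\gamma=\sum_{u\in V}D^{r\to u}\gamma$. For $v\in V^\bullet$, $\gamma_{v\to k}$ is $\gamma$ with the vertex $v$ replaced by a new covertex numbered $k$. For $\gamma\in\mathcal{F}_{n,p}$ define, and extend linearly, $d_H\gamma=D^{r_n}\gamma$, $d_V\gamma=\wedge\sum_{v\in V^\bullet}\gamma_{v\to p+1}$, $d\gamma=(-1)^{n+p}d_H\gamma+d_V\gamma$. This gives $d_H:\Omega_{n,p}\to\Omega_{n-1,p}$ (with $d_H=0$ on $\Omega_{0,p}$) and $d_V:\Omega_{n,p}\to\Omega_{n,p+1}$. Contraction and Lie derivative. For $\tau\in\mathcal{F}_1$, $\gamma_{k\to\tau}$ is the sum of all forests obtained by replacing covertex $k$ by $\tau$: the root of $\tau$ inherits the outgoing edge of $k$ (or its root number if $k$ is a root), and the predecessors of $k$ are grafted onto the nodes of $\tau$ in all possible ways. The contraction is $i_\tau\gamma=p\,\gamma_{p\to\tau}$ for $\gamma\in\mathcal{F}_{n,p}$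 (and $i_\tau\gamma=0$ if $p=0$), extended bilinearly to $i_\tau:\Omega_{n,p}\to\Omega_{n,p-1}$, $\tau\in\Omega_1$. The aromatic Lie derivative is $\mathcal{L}_\tau\gamma=(d\,i_\tau+i_\tau d)\gamma$ for $\gamma\in\Omega_{n,p}$, $\tau\in\Omega_1$. Interior Euler operator. For $\gamma\in\Omega_{0,1}$, $I\gamma$ is obtained (linearly) by unplugging all the predecessors of the covertex (the covertex itself included, if it carries a loop), plugging them back onto the vertices in all possible ways (sum), and multiplying by $-1$ if the number of predecessors is odd. Let $\mathcal{I}_1=I(\Omega_{0,1})$ (source forms) and $\delta_V=I\circ d_V:\Omega_0\to\mathcal{I}_1$. Symmetries. $\tau\in\Omega_1$ is a divergence symmetry for $\gamma$ if there is an aromatic form $\eta$ with $\mathcal{L}_\tau\gamma=d_H\eta$. For a source form $\gamma\in\mathcal{I}_1$, $\tau\in\Omega_1$ is a generator of a conservation law $\eta\in\Omega_1$ for $\gamma$ if $i_\tau\gamma=d_H\eta$. *)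

theory Defs
  imports
    Complex_Main
    "HOL-Library.Poly_Mapping"
    "HOL-Library.FuncSet"
    "HOL-Library.Nat_Bijection"
    "HOL-Combinatorics.Permutations"
begin

section \<open>Aromatic forests\<close>

text \<open>
  The numbering of covertices and of roots is given by lists: the covertex (root) numbered
  \<open>k\<close> is the entry with index \<open>k - 1\<close>.  The vertices are the remaining nodes.
\<close>

record 'a graph =
  nodes :: "'a set"
  edges :: "('a \<times> 'a) set"
  coverts :: "'a list"
  roots :: "'a list"

definition vertices :: "'a graph \<Rightarrow> 'a set" where
  "vertices G = nodes G - set (coverts G)"

definition preds :: "'a graph \<Rightarrow> 'a \<Rightarrow> 'a set" where
  "preds G u = {v. (v, u) \<in> edges G}"

text \<open>
  That a connected component has at most one root is a consequence: a component with
  \<open>k\<close> nodes and \<open>j\<close> roots has \<open>k - j\<close> edges.  The empty graph is allowed.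
\<close>

definition aromatic_graph :: "'a graph \<Rightarrow> bool" where
  "aromatic_graph G \<longleftrightarrow>
     finite (nodes G) \<and> edges G \<subseteq> nodes G \<times> nodes G \<and>
     distinct (coverts G) \<and> set (coverts G) \<subseteq> nodes G \<and>
     distinct (roots G) \<and> set (roots G) \<subseteq> nodes G \<and>
     (\<forall>v\<in>set (roots G). \<nexists>w. (v, w) \<in> edges G) \<and>
     (\<forall>v\<in>nodes G - set (roots G). \<exists>!w. (v, w) \<in> edges G)"

definition relabel :: "('a \<Rightarrow> 'b) \<Rightarrow> 'a graph \<Rightarrow> 'b graph" where
  "relabel f G =
     \<lparr>nodes = f ` nodes G, edges = map_prod f f ` edges G,
      coverts = map f (coverts G), roots = map f (roots G)\<rparr>"

definition graph_iso :: "'a graph \<Rightarrow> 'b graph \<Rightarrow> bool" where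
  "graph_iso G H \<longleftrightarrow> aromatic_graph G \<and> aromatic_graph H \<and>
     (\<exists>f. inj_on f (nodes G) \<and> H = relabel f G)"

lemma relabel_simps [simp]:
  "nodes (relabel f G) = f ` nodes G"
  "edges (relabel f G) = map_prod f f ` edges G"
  "coverts (relabel f G) = map f (coverts G)"
  "roots (relabel f G) = map f (roots G)"
  by (simp_all add: relabel_def)

lemma relabel_id [simp]: "relabel id G = G"
  by (cases G) (simp add: relabel_def map_prod.id)

lemma relabel_relabel: "relabel g (relabel f G) = relabel (g \<circ> f) G"
  by (simp add: relabel_def image_image image_comp map_prod_compose)

lemma relabel_cong:
  assumes "aromatic_graph G" "\<And>v. v \<in> nodes G \<Longrightarrow> f v = g v"
  shows "relabel f G = relabel g G"
proof -
  have sub: "edges G \<subseteq> nodes G \<times> nodes G" "set (coverts G) \<subseteq> nodes G" "set (roots G) \<subseteq> nodes G"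
    using assms(1) by (simp_all add: aromatic_graph_def)
  have "f ` nodes G = g ` nodes G" "map f (coverts G) = map g (coverts G)"
    "map f (roots G) = map g (roots G)"
    using assms(2) sub by auto
  moreover have "map_prod f f ` edges G = map_prod g g ` edges G"
    by (rule image_cong) (use assms(2) sub in auto)
  ultimately show ?thesis by (simp add: relabel_def)
qed

lemma ex1_transfer:
  assumes "\<exists>!w. P w" shows "\<exists>!z. \<exists>w. P w \<and> z = h w"
proof -
  from assms obtain w where "P w" "\<And>w'. P w' \<Longrightarrow> w' = w" by (elim ex1E) blast
  then show ?thesis by (intro ex1I[of _ "h w"]) metis+
qed

lemma edge_in_nodes:
  assumes "aromatic_graph G" "(v, w) \<in> edges G"
  shows "v \<in> nodes G" "w \<in> nodes G"
  using assms by (auto simp: aromatic_graph_def)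

lemma aromatic_graph_relabel:
  assumes G: "aromatic_graph G" and f: "inj_on f (nodes G)"
  shows "aromatic_graph (relabel f G)"
proof -
  have e: "(f v, w') \<in> map_prod f f ` edges G \<longleftrightarrow> (\<exists>w. w' = f w \<and> (v, w) \<in> edges G)"
    if "v \<in> nodes G" for v w'
  proof
    assume "(f v, w') \<in> map_prod f f ` edges G"
    then obtain a b where ab: "(a, b) \<in> edges G" "f v = f a" "w' = f b" by (auto simp: map_prod_def)
    have "v = a" using inj_onD[OF f ab(2) that edge_in_nodes(1)[OF G ab(1)]] .
    with ab show "\<exists>w. w' = f w \<and> (v, w) \<in> edges G" by blast
  next
    assume "\<exists>w. w' = f w \<and> (v, w) \<in> edges G"
    then show "(f v, w') \<in> map_prod f f ` edges G" by (metis image_eqI map_prod_simp)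
  qed
  have r: "set (roots G) \<subseteq> nodes G" "set (coverts G) \<subseteq> nodes G"
    using G by (auto simp: aromatic_graph_def)
  have uniq: "\<exists>!w'. (f v, w') \<in> map_prod f f ` edges G"
    if v: "v \<in> nodes G" "v \<notin> set (roots G)" for v
  proof -
    have "\<exists>!w. (v, w) \<in> edges G"
      using G v by (simp add: aromatic_graph_def)
    then obtain w where "(v, w) \<in> edges G" "\<And>w'. (v, w') \<in> edges G \<Longrightarrow> w' = w"
      by blast
    then show ?thesis unfolding e[OF v(1)] by (intro ex1I[of _ "f w"]) metis+
  qed
  have "\<forall>v'\<in>f ` nodes G - f ` set (roots G). \<exists>!w'. (v', w') \<in> map_prod f f ` edges G"
  proof
    fix v' assume a: "v' \<in> f ` nodes G - f ` set (roots G)"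
    then obtain v where v: "v \<in> nodes G" "v' = f v" by (elim DiffE imageE)
    with a have "v \<notin> set (roots G)" by (meson DiffD2 imageI)
    from uniq[OF v(1) this] show "\<exists>!w'. (v', w') \<in> map_prod f f ` edges G" unfolding v(2) .
  qed
  moreover have "\<nexists>w. (f v, w) \<in> map_prod f f ` edges G" if "v \<in> set (roots G)" for v
  proof -
    have v: "v \<in> nodes G" "\<And>w. (v, w) \<notin> edges G"
      using that r G by (auto simp: aromatic_graph_def)
    show ?thesis unfolding e[OF v(1)] using v(2) by simp
  qed
  then have "\<forall>v'\<in>f ` set (roots G). \<nexists>w. (v', w) \<in> map_prod f f ` edges G"
    by (simp only: ball_simps) simp
  moreover have "distinct (map f (roots G))" "distinct (map f (coverts G))"
    using G r inj_on_subset[OF f] by (simp_all add: aromatic_graph_def distinct_map)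
  moreover have "map_prod f f ` edges G \<subseteq> f ` nodes G \<times> f ` nodes G"
    using edge_in_nodes[OF G] by auto
  moreover have "finite (nodes G)" using G by (simp add: aromatic_graph_def)
  moreover have "f ` set (roots G) \<subseteq> f ` nodes G" "f ` set (coverts G) \<subseteq> f ` nodes G"
    using r by (simp_all add: image_mono)
  ultimately show ?thesis
    unfolding aromatic_graph_def relabel_simps set_map by (intro conjI finite_imageI)
qed

lemma graph_isoI:
  "aromatic_graph G \<Longrightarrow> inj_on f (nodes G) \<Longrightarrow> graph_iso G (relabel f G)"
  using aromatic_graph_relabel by (auto simp: graph_iso_def)

lemma graph_iso_refl: "aromatic_graph G \<Longrightarrow> graph_iso G G"
  using graph_isoI[of G id] by simp

lemma graph_iso_sym:
  assumes "graph_iso G H" shows "graph_iso H G"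
proof -
  from assms obtain f where f: "inj_on f (nodes G)" "H = relabel f G"
    and G: "aromatic_graph G" "aromatic_graph H" by (auto simp: graph_iso_def)
  define h where "h = inv_into (nodes G) f"
  have "relabel h H = relabel id G"
    unfolding f(2) relabel_relabel using G(1) by (rule relabel_cong) (simp add: f(1) h_def)
  then have h: "relabel h H = G" unfolding relabel_id .
  have "inj_on h (nodes H)" unfolding f(2) h_def relabel_simps by (rule inj_on_inv_into) simp
  from graph_isoI[OF G(2) this] show ?thesis unfolding h .
qed

lemma graph_iso_trans:
  assumes "graph_iso G H" "graph_iso H K" shows "graph_iso G K"
proof -
  from assms(1) obtain f where f: "inj_on f (nodes G)" "H = relabel f G" and G: "aromatic_graph G"
    by (auto simp: graph_iso_def)
  from assms(2) obtain g where g: "inj_on g (nodes H)" "K = relabel g H"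
    by (auto simp: graph_iso_def)
  have "inj_on (g \<circ> f) (nodes G)" using f g(1) by (simp add: comp_inj_on)
  from graph_isoI[OF G this] show ?thesis unfolding g(2) f(2) relabel_relabel .
qed

quotient_type forest = "nat graph" / partial: "graph_iso"
proof (rule part_equivpI)
  have "graph_iso (\<lparr>nodes = {}, edges = {}, coverts = [], roots = []\<rparr> :: nat graph)
    (\<lparr>nodes = {}, edges = {}, coverts = [], roots = []\<rparr> :: nat graph)"
    by (rule graph_iso_refl) (simp add: aromatic_graph_def)
  then show "\<exists>G :: nat graph. graph_iso G G" by blast
  show "symp (graph_iso :: nat graph \<Rightarrow> nat graph \<Rightarrow> bool)"
    by (rule sympI) (rule graph_iso_sym)
  show "transp (graph_iso :: nat graph \<Rightarrow> nat graph \<Rightarrow> bool)"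
    by (rule transpI) (rule graph_iso_trans)
qed

lemma abs_forest_eq: "graph_iso G H \<Longrightarrow> abs_forest G = abs_forest H"
  by (rule Quotient_rel_abs[OF Quotient_forest])

lemma abs_forest_relabel:
  "aromatic_graph G \<Longrightarrow> inj_on f (nodes G) \<Longrightarrow> abs_forest (relabel f G) = abs_forest G"
  by (rule abs_forest_eq[symmetric]) (rule graph_isoI)

lift_definition num_roots :: "forest \<Rightarrow> nat" is "\<lambda>G. length (roots G)"
  by (auto simp: graph_iso_def)

lift_definition num_coverts :: "forest \<Rightarrow> nat" is "\<lambda>G. length (coverts G)"
  by (auto simp: graph_iso_def)

definition forests :: "nat \<Rightarrow> nat \<Rightarrow> forest set" where
  "forests n p = {\<gamma>. num_roots \<gamma> = n \<and> num_coverts \<gamma> = p}"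

section \<open>Formal linear combinations\<close>

instantiation poly_mapping :: (type, real_vector) real_vector
begin

lift_definition scaleR_poly_mapping :: "real \<Rightarrow> ('a \<Rightarrow>\<^sub>0 'b) \<Rightarrow> ('a \<Rightarrow>\<^sub>0 'b)"
  is "\<lambda>c f k. c *\<^sub>R f k"
  by (rule finite_subset) auto

instance
  by standard (transfer; simp add: fun_eq_iff scaleR_add_right scaleR_add_left)+

end

type_synonym form = "forest \<Rightarrow>\<^sub>0 real"

definition graph_form :: "nat graph \<Rightarrow> form" where
  "graph_form G = Poly_Mapping.single (abs_forest G) 1"

definition linear_extension :: "(forest \<Rightarrow> form) \<Rightarrow> form \<Rightarrow> form" where
  "linear_extension F x = (\<Sum>\<gamma>\<in>Poly_Mapping.keys x. Poly_Mapping.lookup x \<gamma> *\<^sub>R F \<gamma>)"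

lemma graph_form_relabel:
  "aromatic_graph G \<Longrightarrow> inj_on f (nodes G) \<Longrightarrow> graph_form (relabel f G) = graph_form G"
  by (simp add: graph_form_def abs_forest_relabel)

section \<open>Aromatic forms\<close>

text \<open>
  A permutation \<open>\<sigma>\<close> gives the root (covertex) numbered \<open>i\<close> the new number \<open>\<sigma> i\<close>; numbers start
  from \<open>0\<close> here.
\<close>

lemma roots_update_relabel:
  "relabel f (G\<lparr>roots := xs\<rparr>) = (relabel f G)\<lparr>roots := map f xs\<rparr>"
  by (simp add: relabel_def)

lemma coverts_update_relabel:
  "relabel f (G\<lparr>coverts := xs\<rparr>) = (relabel f G)\<lparr>coverts := map f xs\<rparr>"
  by (simp add: relabel_def)

lift_definition wedge_roots_forest :: "forest \<Rightarrow> form" is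
  "\<lambda>G. (1 / fact (length (roots G))) *\<^sub>R
     (\<Sum>\<sigma> | \<sigma> permutes {..<length (roots G)}.
        of_int (sign \<sigma>) *\<^sub>R graph_form (G\<lparr>roots := permute_list (inv \<sigma>) (roots G)\<rparr>))"
proof -
  fix G H :: "nat graph"
  assume "graph_iso G H"
  then obtain f where f: "inj_on f (nodes G)" "H = relabel f G" and G: "aromatic_graph G"
    by (auto simp: graph_iso_def)
  have "graph_form (H\<lparr>roots := permute_list (inv \<sigma>) (roots H)\<rparr>)
      = graph_form (G\<lparr>roots := permute_list (inv \<sigma>) (roots G)\<rparr>)"
    if "\<sigma> permutes {..<length (roots G)}" for \<sigma>
  proof -
    note p = permutes_inv[OF that]
    have "aromatic_graph (G\<lparr>roots := permute_list (inv \<sigma>) (roots G)\<rparr>)"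
      using G p by (simp add: aromatic_graph_def)
    from graph_form_relabel[OF this, of f] f p show ?thesis
      by (simp add: roots_update_relabel permute_list_map)
  qed
  then show "?thesis G H" by (simp add: f(2))
qed

lift_definition wedge_coverts_forest :: "forest \<Rightarrow> form" is
  "\<lambda>G. (1 / fact (length (coverts G))) *\<^sub>R
     (\<Sum>\<sigma> | \<sigma> permutes {..<length (coverts G)}.
        of_int (sign \<sigma>) *\<^sub>R graph_form (G\<lparr>coverts := permute_list (inv \<sigma>) (coverts G)\<rparr>))"
proof -
  fix G H :: "nat graph"
  assume "graph_iso G H"
  then obtain f where f: "inj_on f (nodes G)" "H = relabel f G" and G: "aromatic_graph G"
    by (auto simp: graph_iso_def)
  have "graph_form (H\<lparr>coverts := permute_list (inv \<sigma>) (coverts H)\<rparr>)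
      = graph_form (G\<lparr>coverts := permute_list (inv \<sigma>) (coverts G)\<rparr>)"
    if "\<sigma> permutes {..<length (coverts G)}" for \<sigma>
  proof -
    note p = permutes_inv[OF that]
    have "aromatic_graph (G\<lparr>coverts := permute_list (inv \<sigma>) (coverts G)\<rparr>)"
      using G p by (simp add: aromatic_graph_def)
    from graph_form_relabel[OF this, of f] f p show ?thesis
      by (simp add: coverts_update_relabel permute_list_map)
  qed
  then show "?thesis G H" by (simp add: f(2))
qed

definition wedge :: "form \<Rightarrow> form" where
  "wedge x = linear_extension wedge_roots_forest (linear_extension wedge_coverts_forest x)"

definition aromatic_forms :: "nat \<Rightarrow> nat \<Rightarrow> form set" where
  "aromatic_forms n p = wedge ` span ((\<lambda>\<gamma>. Poly_Mapping.single \<gamma> 1) ` forests n p)"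

section \<open>Derivatives\<close>

definition add_root_edge :: "'a \<Rightarrow> 'a \<Rightarrow> 'a graph \<Rightarrow> 'a graph" where
  "add_root_edge r u G = G\<lparr>edges := insert (r, u) (edges G), roots := remove1 r (roots G)\<rparr>"

lemma map_remove1_inj:
  "inj_on f (insert x (set xs)) \<Longrightarrow> map f (remove1 x xs) = remove1 (f x) (map f xs)"
  by (induction xs) (auto simp: inj_on_def)

lemma relabel_add_root_edge:
  assumes "aromatic_graph G" "r \<in> set (roots G)" "inj_on f (nodes G)"
  shows "relabel f (add_root_edge r u G) = add_root_edge (f r) (f u) (relabel f G)"
proof -
  have "inj_on f (insert r (set (roots G)))"
    by (rule inj_on_subset[OF assms(3)]) (use assms in \<open>auto simp: aromatic_graph_def\<close>)
  then show ?thesis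
    by (simp add: relabel_def add_root_edge_def map_remove1_inj)
qed

lemma aromatic_graph_add_root_edge:
  assumes "aromatic_graph G" "r \<in> set (roots G)" "u \<in> nodes G"
  shows "aromatic_graph (add_root_edge r u G)"
proof -
  have out: "(v, z) \<in> edges (add_root_edge r u G) \<longleftrightarrow> (if v = r then z = u else (v, z) \<in> edges G)"
    for v z using assms by (auto simp: aromatic_graph_def add_root_edge_def)
  have rts: "set (roots (add_root_edge r u G)) = set (roots G) - {r}"
    using assms by (auto simp: aromatic_graph_def add_root_edge_def)
  have "\<exists>!z. (v, z) \<in> edges (add_root_edge r u G)"
    if "v \<in> nodes G - (set (roots G) - {r})" for v
    using assms(1) that unfolding out by (cases "v = r") (simp_all add: aromatic_graph_def)
  moreover have "\<nexists>z. (v, z) \<in> edges (add_root_edge r u G)" if "v \<in> set (roots G) - {r}" for v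
    using assms(1) that unfolding out by (simp add: aromatic_graph_def)
  moreover have "edges (add_root_edge r u G) \<subseteq> nodes G \<times> nodes G"
    using assms by (auto simp: aromatic_graph_def add_root_edge_def)
  ultimately show ?thesis
    using assms(1) unfolding aromatic_graph_def rts
    by (auto simp: add_root_edge_def)
qed

lift_definition d_H_forest :: "forest \<Rightarrow> form" is
  "\<lambda>G. if roots G = [] then 0
       else (\<Sum>u\<in>nodes G. graph_form (add_root_edge (last (roots G)) u G))"
proof -
  fix G H :: "nat graph"
  assume "graph_iso G H"
  then obtain f where f: "inj_on f (nodes G)" "H = relabel f G" and G: "aromatic_graph G"
    by (auto simp: graph_iso_def)
  have "graph_form (add_root_edge (last (roots H)) (f u) H)
      = graph_form (add_root_edge (last (roots G)) u G)"
    if "roots G \<noteq> []" "u \<in> nodes G" for u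
    using graph_form_relabel[OF aromatic_graph_add_root_edge[OF G _ that(2)], of "last (roots G)" f]
      relabel_add_root_edge[OF G _ f(1), of "last (roots G)" u] that f
    by (simp add: last_map) (simp add: add_root_edge_def)
  then show "?thesis G H"
    using f by (simp add: sum.reindex)
qed

definition d_H :: "form \<Rightarrow> form" where
  "d_H = linear_extension d_H_forest"

definition make_covert :: "'a \<Rightarrow> 'a graph \<Rightarrow> 'a graph" where
  "make_covert v G = G\<lparr>coverts := coverts G @ [v]\<rparr>"

lift_definition covert_sum :: "forest \<Rightarrow> form" is
  "\<lambda>G. \<Sum>v\<in>vertices G. graph_form (make_covert v G)"
proof -
  fix G H :: "nat graph"
  assume "graph_iso G H"
  then obtain f where f: "inj_on f (nodes G)" "H = relabel f G" and G: "aromatic_graph G"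
    by (auto simp: graph_iso_def)
  have v: "vertices H = f ` vertices G"
    using f G by (subst vertices_def, simp add: vertices_def, subst inj_on_image_set_diff[OF f(1)])
      (auto simp: aromatic_graph_def)
  have i: "inj_on f (vertices G)"
    by (rule inj_on_subset[OF f(1)]) (auto simp: vertices_def)
  have "graph_form (make_covert (f v) H) = graph_form (make_covert v G)"
    if "v \<in> vertices G" for v
  proof -
    have "aromatic_graph (make_covert v G)"
      using G that by (auto simp: aromatic_graph_def make_covert_def vertices_def)
    from graph_form_relabel[OF this, of f] f show ?thesis
      by (simp add: make_covert_def coverts_update_relabel)
  qed
  then show "?thesis G H" using i by (simp add: v sum.reindex)
qed

definition d_V :: "form \<Rightarrow> form" where
  "d_V = linear_extension (\<lambda>\<gamma>. wedge (covert_sum \<gamma>))"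

definition d_total :: "form \<Rightarrow> form" where
  "d_total = linear_extension
     (\<lambda>\<gamma>. (-1) ^ (num_roots \<gamma> + num_coverts \<gamma>) *\<^sub>R d_H (Poly_Mapping.single \<gamma> 1)
        + d_V (Poly_Mapping.single \<gamma> 1))"

section \<open>Contraction and Lie derivative\<close>

text \<open>
  \<open>substitute c \<phi> T G\<close> is \<open>G\<close> with the covertex \<open>c\<close> replaced by the tree \<open>T\<close> (one root, no
  covertex), where each predecessor \<open>v\<close> of \<open>c\<close> is grafted onto the node \<open>\<phi> v\<close> of \<open>T\<close>.
  If \<open>c\<close> carries a loop, then \<open>c\<close> is one of its predecessors and the root of \<open>T\<close> takes its place.
\<close>

definition substitute :: "'a \<Rightarrow> ('a \<Rightarrow> 'b) \<Rightarrow> 'b graph \<Rightarrow> 'a graph \<Rightarrow> ('a + 'b) graph" where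
  "substitute c \<phi> T G =
     (let src = (\<lambda>v. if v = c then Inr (hd (roots T)) else Inl v) in
      \<lparr>nodes = (nodes G - {c}) <+> nodes T,
       edges = {(src v, Inl w) | v w. (v, w) \<in> edges G \<and> w \<noteq> c}
             \<union> {(src v, Inr (\<phi> v)) | v. v \<in> preds G c}
             \<union> {(Inr x, Inr y) | x y. (x, y) \<in> edges T},
       coverts = map Inl (remove1 c (coverts G)),
       roots = map src (roots G)\<rparr>)"

lemma aromatic_graph_substitute:
  assumes G: "aromatic_graph G" and c: "c \<in> set (coverts G)" and T: "aromatic_graph T"
    and r: "roots T = [r]" and phi: "\<phi> \<in> preds G c \<rightarrow> nodes T"
  shows "aromatic_graph (substitute c \<phi> T G)"
proof -
  let ?S = "substitute c \<phi> T G"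
  let ?src = "\<lambda>v. if v = c then Inr r else Inl v"
  have rT: "r \<in> nodes T" "\<And>y. (r, y) \<notin> edges T"
    "\<And>x. x \<in> nodes T \<Longrightarrow> x \<noteq> r \<Longrightarrow> \<exists>!y. (x, y) \<in> edges T"
    using T r by (auto simp: aromatic_graph_def)
  have cG: "c \<in> nodes G" using G c by (auto simp: aromatic_graph_def)
  have isrc: "inj ?src" by (auto simp: inj_def)
  have rts: "roots ?S = map ?src (roots G)"
    using r by (auto simp: substitute_def Let_def)
  have E: "edges ?S = {(?src v, Inl w) | v w. (v, w) \<in> edges G \<and> w \<noteq> c}
       \<union> {(?src v, Inr (\<phi> v)) | v. v \<in> preds G c}
       \<union> {(Inr x, Inr y) | x y. (x, y) \<in> edges T}"
    using r by (simp add: substitute_def Let_def)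
  have out: "(?src v, z) \<in> edges ?S \<longleftrightarrow>
      (\<exists>w. (v, w) \<in> edges G \<and> z = (if w = c then Inr (\<phi> v) else Inl w))" for v z
    using rT(2) unfolding E by (auto simp: preds_def split: if_splits)
  have outT: "(Inr x, z) \<in> edges ?S \<longleftrightarrow> (\<exists>y. (x, y) \<in> edges T \<and> z = Inr y)" if "x \<noteq> r" for x z
    using that unfolding E by (auto split: if_splits)
  have N: "nodes ?S = ?src ` nodes G \<union> Inr ` (nodes T - {r})"
    using cG rT(1) by (auto simp: substitute_def Let_def Plus_def)
  have "\<exists>!z. (u, z) \<in> edges ?S" if u: "u \<in> nodes ?S" "u \<notin> set (roots ?S)" for u
  proof (cases "u \<in> ?src ` nodes G")
    case True
    then obtain v where v: "v \<in> nodes G" "u = ?src v" by blast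
    with u(2) have "v \<notin> set (roots G)" unfolding rts set_map by blast
    with v G have "\<exists>!w. (v, w) \<in> edges G" by (auto simp: aromatic_graph_def)
    then show ?thesis unfolding v(2) out by (rule ex1_transfer)
  next
    case False
    with u N obtain x where x: "u = Inr x" "x \<in> nodes T" "x \<noteq> r" by auto
    show ?thesis unfolding x(1) outT[OF x(3)] by (rule ex1_transfer[OF rT(3)[OF x(2,3)]])
  qed
  moreover have "\<nexists>z. (u, z) \<in> edges ?S" if "u \<in> set (roots ?S)" for u
  proof -
    from that rts obtain v where v: "v \<in> set (roots G)" "u = ?src v" by auto
    with G have "\<And>w. (v, w) \<notin> edges G" by (auto simp: aromatic_graph_def)
    then show ?thesis unfolding v(2) out by simp
  qed
  moreover have "edges ?S \<subseteq> nodes ?S \<times> nodes ?S"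
    unfolding E using edge_in_nodes[OF G] edge_in_nodes[OF T] phi rT(1)
    by (auto simp: substitute_def Let_def preds_def split: if_splits)
  moreover have "distinct (roots ?S)" "set (roots ?S) \<subseteq> nodes ?S"
    unfolding rts N using G isrc
    by (auto simp: aromatic_graph_def distinct_map intro: inj_on_subset)
  moreover have "distinct (coverts ?S)" "set (coverts ?S) \<subseteq> nodes ?S" "finite (nodes ?S)"
    using G T by (auto simp: substitute_def Let_def aromatic_graph_def distinct_map)
  ultimately show ?thesis by (simp add: aromatic_graph_def)
qed

lemma preds_relabel:
  assumes G: "aromatic_graph G" and f: "inj_on f (nodes G)" and c: "c \<in> nodes G"
  shows "preds (relabel f G) (f c) = f ` preds G c" "preds G c \<subseteq> nodes G"
proof -
  show "preds G c \<subseteq> nodes G" using edge_in_nodes[OF G] by (auto simp: preds_def)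
  show "preds (relabel f G) (f c) = f ` preds G c"
  proof (rule subset_antisym; rule subsetI)
    fix v' assume "v' \<in> preds (relabel f G) (f c)"
    then obtain a b where ab: "(a, b) \<in> edges G" "v' = f a" "f b = f c"
      by (auto simp: preds_def map_prod_def)
    have "b = c" using inj_onD[OF f ab(3) edge_in_nodes(2)[OF G ab(1)] c] .
    with ab have "a \<in> preds G c" by (simp add: preds_def)
    with ab(2) show "v' \<in> f ` preds G c" by (rule image_eqI)
  next
    fix v' assume "v' \<in> f ` preds G c"
    then obtain v where v: "(v, c) \<in> edges G" "v' = f v" by (auto simp: preds_def)
    have "(f v, f c) \<in> map_prod f f ` edges G" using v(1) by (rule rev_image_eqI) simp
    with v(2) show "v' \<in> preds (relabel f G) (f c)" by (simp add: preds_def)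
  qed
qed

lemma image_edges_relabel:
  assumes "\<And>v w. (v, w) \<in> E \<Longrightarrow> p (s v) = s' (f v)"
    and "\<And>v w. (v, w) \<in> E \<Longrightarrow> Q' (f w) \<longleftrightarrow> Q w"
    and "\<And>w. q (t w) = t' (f w)"
  shows "map_prod p q ` {(s v, t w) | v w. (v, w) \<in> E \<and> Q w}
       = {(s' v, t' w) | v w. (v, w) \<in> map_prod f f ` E \<and> Q' w}" (is "?L = ?R")
proof (rule subset_antisym; rule subsetI)
  fix z assume "z \<in> ?L"
  then obtain v w where vw: "(v, w) \<in> E" "Q w" "z = (p (s v), q (t w))" by auto
  have "(f v, f w) \<in> map_prod f f ` E" using vw(1) by (rule rev_image_eqI) simp
  moreover have "z = (s' (f v), t' (f w))" "Q' (f w)" using assms vw by simp_all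
  ultimately show "z \<in> ?R" unfolding mem_Collect_eq by (intro exI conjI)
next
  fix z assume "z \<in> ?R"
  then obtain v w where vw: "(v, w) \<in> E" "Q' (f w)" "z = (s' (f v), t' (f w))" by auto
  have Q: "Q w" and z: "z = map_prod p q (s v, t w)" using assms vw by simp_all
  have "(s v, t w) \<in> {(s v, t w) | v w. (v, w) \<in> E \<and> Q w}"
    unfolding mem_Collect_eq using vw(1) Q by (intro exI conjI) (rule refl)
  with z show "z \<in> ?L" by (rule image_eqI)
qed

lemma relabel_substitute:
  assumes G: "aromatic_graph G" and c: "c \<in> set (coverts G)" and T: "aromatic_graph T"
    and r: "roots T = [r]" and f: "inj_on f (nodes G)"
    and psi: "\<And>v. v \<in> preds G c \<Longrightarrow> \<psi> (f v) = g (\<phi> v)"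
  shows "relabel (map_sum f g) (substitute c \<phi> T G)
       = substitute (f c) \<psi> (relabel g T) (relabel f G)"
proof -
  have cG: "c \<in> nodes G" using G c by (auto simp: aromatic_graph_def)
  have eq: "f v = f c \<longleftrightarrow> v = c" if "v \<in> nodes G" for v
    using inj_onD[OF f _ that cG] by auto
  have ed: "\<And>v w. (v, w) \<in> edges G \<Longrightarrow> v \<in> nodes G \<and> w \<in> nodes G"
    using edge_in_nodes[OF G] by blast
  have pr: "preds (relabel f G) (f c) = f ` preds G c"
    by (rule preds_relabel(1)[OF G f cG])
  have 1: "map_sum f g ` ((nodes G - {c}) <+> nodes T)
      = (f ` nodes G - {f c}) <+> g ` nodes T"
  proof -
    have "f ` nodes G - {f c} = f ` (nodes G - {c})"
      using inj_on_image_set_diff[OF f, of "nodes G" "{c}"] cG by simp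
    then show ?thesis by (simp only:) (simp add: Plus_def image_Un image_image)
  qed
  have inj: "inj_on f (insert c (set (coverts G)))"
    by (rule inj_on_subset[OF f]) (use G cG in \<open>auto simp: aromatic_graph_def\<close>)
  have sub: "set (roots G) \<subseteq> nodes G" using G by (auto simp: aromatic_graph_def)
  let ?src = "\<lambda>v. if v = c then Inr r else Inl v"
  let ?src' = "\<lambda>v. if v = f c then Inr (g r) else Inl v"
  have src: "map_sum f g (?src v) = ?src' (f v)" if "v \<in> nodes G" for v
    using eq[OF that] by auto
  let ?m = "map_prod (map_sum f g) (map_sum f g)"
  have 2: "?m ` {(?src v, Inl w) | v w. (v, w) \<in> edges G \<and> w \<noteq> c}
      = {(?src' v, Inl w) | v w. (v, w) \<in> map_prod f f ` edges G \<and> w \<noteq> f c}" (is "?m ` ?A = ?B")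
  proof (rule image_edges_relabel)
    fix v w assume "(v, w) \<in> edges G"
    with ed have "v \<in> nodes G" "w \<in> nodes G" by blast+
    then show "map_sum f g (?src v) = ?src' (f v)" "f w \<noteq> f c \<longleftrightarrow> w \<noteq> c"
      using src eq by blast+
  qed simp
  have 3: "?m ` {(?src v, Inr (\<phi> v)) | v. v \<in> preds G c}
      = {(?src' v, Inr (\<psi> v)) | v. v \<in> f ` preds G c}"
  proof -
    have "v \<in> preds G c \<Longrightarrow> ?m (?src v, Inr (\<phi> v)) = (?src' (f v), Inr (\<psi> (f v)))" for v
      using src[of v] psi[of v] ed by (auto simp: preds_def)
    then have "?m ` (\<lambda>v. (?src v, Inr (\<phi> v))) ` preds G c
        = (\<lambda>v. (?src' v, Inr (\<psi> v))) ` f ` preds G c"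
      unfolding image_image by (rule image_cong[OF refl])
    then show ?thesis by (simp only: Setcompr_eq_image Collect_mem_eq)
  qed
  have 4: "?m ` {(Inr x, Inr y) | x y. (x, y) \<in> edges T}
      = {(Inr x, Inr y) | x y. (x, y) \<in> map_prod g g ` edges T}"
    using image_edges_relabel[where E = "edges T" and f = g and p = "map_sum f g" and
        q = "map_sum f g" and s = Inr and s' = Inr and t = Inr and t' = Inr and
        Q = "\<lambda>_. True" and Q' = "\<lambda>_. True"] by simp
  have 5: "map (map_sum f g) (map ?src (roots G)) = map ?src' (map f (roots G))"
    unfolding map_map o_def by (rule map_cong[OF refl], rule src) (use sub in blast)
  have 6: "map (map_sum f g) (map Inl (remove1 c (coverts G)))
      = map Inl (remove1 (f c) (map f (coverts G)))"
    unfolding map_remove1_inj[OF inj, symmetric] by simp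
  show ?thesis
    unfolding substitute_def Let_def pr relabel_simps r list.map list.sel
    unfolding relabel_def graph.simps image_Un 1 2 3 4 5 6 ..
qed

lemma bij_betw_PiE_relabel:
  assumes "inj_on f P" "inj_on g A"
  shows "bij_betw (\<lambda>\<phi>. \<lambda>v\<in>f ` P. g (\<phi> (inv_into P f v))) (P \<rightarrow>\<^sub>E A) (f ` P \<rightarrow>\<^sub>E g ` A)"
proof (rule bij_betw_byWitness[where f' = "\<lambda>\<psi>. \<lambda>v\<in>P. inv_into A g (\<psi> (f v))"])
  show "\<forall>\<phi>\<in>P \<rightarrow>\<^sub>E A. (\<lambda>v\<in>P. inv_into A g ((\<lambda>v\<in>f ` P. g (\<phi> (inv_into P f v))) (f v))) = \<phi>"
  proof (intro ballI ext)
    fix \<phi> v assume phi: "\<phi> \<in> P \<rightarrow>\<^sub>E A"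
    show "(\<lambda>v\<in>P. inv_into A g ((\<lambda>v\<in>f ` P. g (\<phi> (inv_into P f v))) (f v))) v = \<phi> v"
    proof (cases "v \<in> P")
      case True
      then show ?thesis using PiE_mem[OF phi True] assms by simp
    next
      case False
      then show ?thesis using PiE_arb[OF phi False] by simp
    qed
  qed
  show "\<forall>\<psi>\<in>f ` P \<rightarrow>\<^sub>E g ` A.
      (\<lambda>v\<in>f ` P. g ((\<lambda>v\<in>P. inv_into A g (\<psi> (f v))) (inv_into P f v))) = \<psi>"
  proof (intro ballI ext)
    fix \<psi> v assume psi: "\<psi> \<in> f ` P \<rightarrow>\<^sub>E g ` A"
    show "(\<lambda>v\<in>f ` P. g ((\<lambda>v\<in>P. inv_into A g (\<psi> (f v))) (inv_into P f v))) v = \<psi> v"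
    proof (cases "v \<in> f ` P")
      case True
      then show ?thesis
        using f_inv_into_f[OF PiE_mem[OF psi True]] by (simp add: f_inv_into_f inv_into_into)
    next
      case False
      then show ?thesis using PiE_arb[OF psi False] by (simp only: restrict_apply if_False)
    qed
  qed
  show "(\<lambda>\<phi>. \<lambda>v\<in>f ` P. g (\<phi> (inv_into P f v))) ` (P \<rightarrow>\<^sub>E A) \<subseteq> f ` P \<rightarrow>\<^sub>E g ` A"
    unfolding image_subset_iff restrict_PiE_iff
    by (intro ballI imageI) (erule PiE_mem, erule inv_into_into)
  show "(\<lambda>\<psi>. \<lambda>v\<in>P. inv_into A g (\<psi> (f v))) ` (f ` P \<rightarrow>\<^sub>E g ` A) \<subseteq> P \<rightarrow>\<^sub>E A"
    unfolding image_subset_iff restrict_PiE_iff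
    by (intro ballI inv_into_into) (erule PiE_mem, erule imageI)
qed

lemma inj_on_map_sum:
  assumes "inj_on f A" "inj_on g B"
  shows "inj_on (map_sum f g) (A <+> B)"
proof (rule inj_onI)
  fix x y assume "x \<in> A <+> B" "y \<in> A <+> B" "map_sum f g x = map_sum f g y"
  then show "x = y"
    using inj_onD[OF assms(1)] inj_onD[OF assms(2)] by (cases x; cases y) (simp_all add: Plus_def image_iff)
qed

text \<open>
  \<open>subst_last \<tau> \<gamma>\<close> is the sum written \<open>\<gamma>\<^bsub>p\<rightarrow>\<tau>\<^esub>\<close>, where \<open>p\<close> is the number of covertices of \<open>\<gamma>\<close>;
  it is set to \<open>0\<close> if \<open>p = 0\<close> or if \<open>\<tau>\<close> is not in \<open>forests 1 0\<close>.  The encoding of the disjoint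
  union into natural numbers only chooses a representative of the isomorphism class.
\<close>

lift_definition subst_last :: "forest \<Rightarrow> forest \<Rightarrow> form" is
  "\<lambda>T G. if length (roots T) = 1 \<and> coverts T = [] \<and> coverts G \<noteq> [] then
      (let c = last (coverts G) in
       \<Sum>\<phi>\<in>preds G c \<rightarrow>\<^sub>E nodes T. graph_form (relabel sum_encode (substitute c \<phi> T G)))
    else 0"
proof -
  fix T T' G G' :: "nat graph"
  assume "graph_iso T T'" "graph_iso G G'"
  then obtain f g where f: "inj_on f (nodes G)" "G' = relabel f G" and G: "aromatic_graph G"
    and g: "inj_on g (nodes T)" "T' = relabel g T" and T: "aromatic_graph T"
    by (auto simp: graph_iso_def)
  show "?thesis T T' G G'"
  proof (cases "length (roots T) = 1 \<and> coverts T = [] \<and> coverts G \<noteq> []")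
    case False
    moreover from this have "\<not> (length (roots T') = 1 \<and> coverts T' = [] \<and> coverts G' \<noteq> [])"
      by (simp add: f(2) g(2))
    ultimately show ?thesis by (simp only: if_False)
  next
    case True
    then obtain r where r: "roots T = [r]" by (auto simp: length_Suc_conv)
    define c where "c = last (coverts G)"
    have c: "c \<in> set (coverts G)" "last (coverts G') = f c"
      using True f by (auto simp: c_def last_map)
    have cG: "c \<in> nodes G" using G c by (auto simp: aromatic_graph_def)
    note pr = preds_relabel[OF G f(1) cG]
    have fP: "inj_on f (preds G c)" using inj_on_subset[OF f(1) pr(2)] .
    have "graph_form (relabel sum_encode (substitute c \<phi> T G))
      = graph_form (relabel sum_encode (substitute (f c)
          (\<lambda>v\<in>f ` preds G c. g (\<phi> (inv_into (preds G c) f v))) T' G'))"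
      (is "_ = graph_form (relabel _ (substitute _ ?psi _ _))")
      if phi: "\<phi> \<in> preds G c \<rightarrow>\<^sub>E nodes T" for \<phi>
    proof -
      let ?S = "substitute c \<phi> T G"
      have S: "aromatic_graph ?S"
        using aromatic_graph_substitute[OF G c(1) T r] phi by auto
      have *: "relabel (map_sum f g) ?S = substitute (f c) ?psi T' G'"
        unfolding f(2) g(2) by (rule relabel_substitute[OF G c(1) T r f(1)]) (simp add: fP)
      have n: "nodes ?S = (nodes G - {c}) <+> nodes T"
        by (simp add: substitute_def Let_def)
      have i: "inj_on (map_sum f g) (nodes ?S)"
        unfolding n by (rule inj_on_map_sum[OF inj_on_subset[OF f(1)] g(1)]) (rule Diff_subset)
      have A: "graph_iso ?S (substitute (f c) ?psi T' G')"
        using graph_isoI[OF S i] unfolding * .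
      have e: "graph_iso K (relabel sum_encode K)"
        if "aromatic_graph K" for K :: "(nat + nat) graph"
        by (rule graph_isoI[OF that]) (rule inj_sum_encode)
      have "aromatic_graph (substitute (f c) ?psi T' G')" using A by (simp add: graph_iso_def)
      from graph_iso_trans[OF graph_iso_sym[OF e[OF S]] graph_iso_trans[OF A e[OF this]]]
      have "abs_forest (relabel sum_encode ?S)
          = abs_forest (relabel sum_encode (substitute (f c) ?psi T' G'))"
        by (rule abs_forest_eq)
      then show ?thesis unfolding graph_form_def by simp
    qed
    then have "(\<Sum>\<phi>\<in>preds G c \<rightarrow>\<^sub>E nodes T. graph_form (relabel sum_encode (substitute c \<phi> T G)))
      = (\<Sum>\<psi>\<in>preds G' (f c) \<rightarrow>\<^sub>E nodes T'.
           graph_form (relabel sum_encode (substitute (f c) \<psi> T' G')))"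
      unfolding f(2) g(2) pr(1) relabel_simps
      by (subst sum.reindex_bij_betw[OF bij_betw_PiE_relabel[OF fP g(1)], symmetric]) simp
    moreover have "length (roots T') = 1 \<and> coverts T' = [] \<and> coverts G' \<noteq> []"
      using True by (simp add: f(2) g(2))
    ultimately show ?thesis
      using True c by (simp add: Let_def c_def[symmetric])
  qed
qed

definition contraction :: "form \<Rightarrow> form \<Rightarrow> form" where
  "contraction \<tau> = linear_extension (\<lambda>\<gamma>.
     linear_extension (\<lambda>t. real (num_coverts \<gamma>) *\<^sub>R subst_last t \<gamma>) \<tau>)"

definition lie_derivative :: "form \<Rightarrow> form \<Rightarrow> form" where
  "lie_derivative \<tau> \<gamma> = d_total (contraction \<tau> \<gamma>) + contraction \<tau> (d_total \<gamma>)"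

section \<open>Interior Euler operator\<close>

definition replug :: "'a \<Rightarrow> ('a \<Rightarrow> 'a) \<Rightarrow> 'a graph \<Rightarrow> 'a graph" where
  "replug c \<phi> G =
     G\<lparr>edges := (edges G - preds G c \<times> {c}) \<union> (\<lambda>v. (v, \<phi> v)) ` preds G c\<rparr>"

lemma aromatic_graph_replug:
  assumes "aromatic_graph G" "\<phi> \<in> preds G c \<rightarrow> nodes G"
  shows "aromatic_graph (replug c \<phi> G)"
proof -
  have out: "(v, z) \<in> edges (replug c \<phi> G) \<longleftrightarrow>
      (\<exists>w. (v, w) \<in> edges G \<and> z = (if w = c then \<phi> v else w))" for v z
    by (auto simp: replug_def preds_def)
  have "\<exists>!z. (v, z) \<in> edges (replug c \<phi> G)" if "v \<in> nodes G" "v \<notin> set (roots G)" for v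
  proof -
    have "\<exists>!w. (v, w) \<in> edges G" using assms that by (auto simp: aromatic_graph_def)
    then show ?thesis unfolding out by (rule ex1_transfer)
  qed
  moreover have "\<nexists>z. (v, z) \<in> edges (replug c \<phi> G)" if "v \<in> set (roots G)" for v
    using assms that unfolding out by (auto simp: aromatic_graph_def)
  moreover have "edges (replug c \<phi> G) \<subseteq> nodes G \<times> nodes G"
    using assms edge_in_nodes[OF assms(1)] by (auto simp: replug_def preds_def)
  ultimately show ?thesis
    using assms(1) by (simp add: aromatic_graph_def replug_def)
qed

lemma relabel_replug:
  assumes G: "aromatic_graph G" and f: "inj_on f (nodes G)" and c: "c \<in> nodes G"
    and psi: "\<And>v. v \<in> preds G c \<Longrightarrow> \<psi> (f v) = f (\<phi> v)"
  shows "relabel f (replug c \<phi> G) = replug (f c) \<psi> (relabel f G)"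
proof -
  note pr = preds_relabel[OF G f c]
  have i: "inj_on (map_prod f f) (nodes G \<times> nodes G)"
    using map_prod_inj_on[OF f f] .
  have "map_prod f f ` (edges G - preds G c \<times> {c})
      = map_prod f f ` edges G - map_prod f f ` (preds G c \<times> {c})"
    using i by (rule inj_on_image_set_diff) (use G pr(2) c in \<open>auto simp: aromatic_graph_def\<close>)
  moreover have "map_prod f f ` (preds G c \<times> {c}) = f ` preds G c \<times> {f c}"
    by auto
  moreover have "map_prod f f ` (\<lambda>v. (v, \<phi> v)) ` preds G c = (\<lambda>v. (v, \<psi> v)) ` f ` preds G c"
    unfolding image_image by (rule image_cong) (auto simp: psi)
  ultimately have "map_prod f f ` edges (replug c \<phi> G) = edges (replug (f c) \<psi> (relabel f G))"
    by (simp add: replug_def pr(1) image_Un)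
  then show ?thesis
    by (simp add: relabel_def replug_def)
qed

text \<open>Set to \<open>0\<close> outside of \<open>forests 0 1\<close>.\<close>

lift_definition euler_forest :: "forest \<Rightarrow> form" is
  "\<lambda>G. if roots G = [] \<and> length (coverts G) = 1 then
      (let c = hd (coverts G) in
       (-1) ^ card (preds G c) *\<^sub>R
         (\<Sum>\<phi>\<in>preds G c \<rightarrow>\<^sub>E vertices G. graph_form (replug c \<phi> G)))
    else 0"
proof -
  fix G H :: "nat graph"
  assume "graph_iso G H"
  then obtain f where f: "inj_on f (nodes G)" "H = relabel f G" and G: "aromatic_graph G"
    by (auto simp: graph_iso_def)
  show "?thesis G H"
  proof (cases "roots G = [] \<and> length (coverts G) = 1")
    case False
    moreover from this have "\<not> (roots H = [] \<and> length (coverts H) = 1)"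
      by (simp add: f(2))
    ultimately show ?thesis by (simp only: if_False)
  next
    case True
    then obtain c where cc: "coverts G = [c]" by (auto simp: length_Suc_conv)
    then have cG: "c \<in> nodes G" using G by (auto simp: aromatic_graph_def)
    note pr = preds_relabel[OF G f(1) cG]
    have fP: "inj_on f (preds G c)" using inj_on_subset[OF f(1) pr(2)] .
    have v: "vertices H = f ` vertices G"
      using inj_on_image_set_diff[OF f(1), of "nodes G" "{c}"] cG f(2) cc
      by (simp add: vertices_def)
    have fV: "inj_on f (vertices G)"
      by (rule inj_on_subset[OF f(1)]) (auto simp: vertices_def)
    have "graph_form (replug c \<phi> G)
      = graph_form (replug (f c) (\<lambda>v\<in>f ` preds G c. f (\<phi> (inv_into (preds G c) f v))) H)"
      (is "_ = graph_form (replug _ ?psi _)")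
      if phi: "\<phi> \<in> preds G c \<rightarrow>\<^sub>E vertices G" for \<phi>
    proof -
      have S: "aromatic_graph (replug c \<phi> G)"
        using phi by (intro aromatic_graph_replug[OF G]) (auto simp: vertices_def)
      have "relabel f (replug c \<phi> G) = replug (f c) ?psi H"
        unfolding f(2) by (rule relabel_replug[OF G f(1) cG]) (simp add: fP)
      with graph_form_relabel[OF S, of f] f(1) show ?thesis by (simp add: replug_def)
    qed
    then have "(\<Sum>\<phi>\<in>preds G c \<rightarrow>\<^sub>E vertices G. graph_form (replug c \<phi> G))
      = (\<Sum>\<psi>\<in>preds H (f c) \<rightarrow>\<^sub>E vertices H. graph_form (replug (f c) \<psi> H))"
      unfolding v unfolding f(2) pr(1)
      by (subst sum.reindex_bij_betw[OF bij_betw_PiE_relabel[OF fP fV], symmetric]) simp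
    moreover have "card (preds H (f c)) = card (preds G c)"
      unfolding f(2) pr(1) by (rule card_image[OF fP])
    ultimately show ?thesis
      using True cc f by (simp add: Let_def)
  qed
qed

definition interior_euler :: "form \<Rightarrow> form" where
  "interior_euler = linear_extension euler_forest"

definition source_forms :: "form set" where
  "source_forms = interior_euler ` aromatic_forms 0 1"

definition delta_V :: "form \<Rightarrow> form" where
  "delta_V \<gamma> = interior_euler (d_V \<gamma>)"

section \<open>Symmetries and conservation laws\<close>

definition divergence_symmetry :: "form \<Rightarrow> form \<Rightarrow> bool" where
  "divergence_symmetry \<tau> \<gamma> \<longleftrightarrow>
     \<tau> \<in> aromatic_forms 1 0 \<and>
     (\<exists>n p. \<exists>\<eta>\<in>aromatic_forms n p. lie_derivative \<tau> \<gamma> = d_H \<eta>)"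

definition generates_conservation_law :: "form \<Rightarrow> form \<Rightarrow> form \<Rightarrow> bool" where
  "generates_conservation_law \<tau> \<eta> \<gamma> \<longleftrightarrow>
     \<gamma> \<in> source_forms \<and> \<tau> \<in> aromatic_forms 1 0 \<and> \<eta> \<in> aromatic_forms 1 0 \<and>
     contraction \<tau> \<gamma> = d_H \<eta>"

end

theory Submission
  imports Defs
begin

text \<open>
  An aromatic Lagrangian has neither roots nor covertices, so its Lie derivative is
  \<open>i\<^sub>\<tau> (d\<^sub>V \<gamma>)\<close>, while the conservation law concerns \<open>i\<^sub>\<tau> (I (d\<^sub>V \<gamma>))\<close>.  Everything follows from
  the claim that \<open>i\<^sub>\<tau> x - i\<^sub>\<tau> (I x)\<close> is a divergence, that is, lies in \<open>d\<^sub>H \<Omega>\<^sub>1\<close>, for every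
  \<open>x \<in> \<Omega>\<^bsub>0,1\<^esub>\<close> (\<open>contraction_interior_euler\<close>): two forms that differ by a divergence are
  divergences together.

  The claim is an integration by parts.  By linearity \<open>x\<close> is one graph \<open>G\<close> with a single
  covertex \<open>c\<close>, and \<open>\<tau>\<close> is one graph \<open>T\<close> with a single root.  Let \<open>P\<close> be the set of predecessors of \<open>c\<close>.  Both
  \<open>i\<^sub>\<tau> G\<close> and \<open>i\<^sub>\<tau> (I G)\<close> are sums over graphs with the same nodes, namely the vertices of \<open>G\<close>
  (say \<open>A\<close>) and the nodes of \<open>T\<close> (say \<open>B\<close>), and they have the same edges except for those
  that leave \<open>P\<close>.  In the first sum these end anywhere in \<open>B\<close>.  In the second one they end
  anywhere in \<open>A\<close>, because \<open>I\<close> has already moved them away from \<open>c\<close>, and the sign is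
  \<open>(-1)\<^bsup>|P|\<^esup>\<close>.  When one of these edges ends anywhere in \<open>A \<union> B\<close> and the rest of the graph is
  kept, the sum is \<open>d\<^sub>H\<close> of the graph in which the source of that edge is a root
  (\<open>sum_rewire_divergence\<close>).  So, up to divergences, an edge can be moved from \<open>B\<close> to \<open>A\<close> at
  the price of a sign; moving all edges, one after the other, gives the claim
  (\<open>alternating_summation_by_parts\<close>).

  A divergence symmetry may be witnessed by a form \<open>\<eta>\<close> of any bidegree.  This gives nothing
  new: \<open>d\<^sub>H \<eta>\<close> equals the Lie derivative, a combination of forests with neither roots nor
  covertices, so it vanishes unless \<open>\<eta>\<close> has one root and no covertex (\<open>d_H_Lagrangian_divergence\<close>).
\<close>

section \<open>Linear extensions\<close>

lemma lookup_scaleR_poly_mapping: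
  "Poly_Mapping.lookup (c *\<^sub>R x) k = c *\<^sub>R Poly_Mapping.lookup x k"
  by (simp add: scaleR_poly_mapping.rep_eq)

lemma linear_extension_superset:
  assumes "finite S" "Poly_Mapping.keys x \<subseteq> S"
  shows "linear_extension F x = (\<Sum>\<gamma>\<in>S. Poly_Mapping.lookup x \<gamma> *\<^sub>R F \<gamma>)"
  unfolding linear_extension_def
  by (rule sum.mono_neutral_left) (use assms in \<open>auto simp: in_keys_iff\<close>)

lemma linear_linear_extension: "linear (linear_extension F)"
proof (rule linearI)
  fix x y :: form and c :: real
  let ?S = "Poly_Mapping.keys x \<union> Poly_Mapping.keys y"
  have "linear_extension F (x + y) = (\<Sum>\<gamma>\<in>?S. Poly_Mapping.lookup (x + y) \<gamma> *\<^sub>R F \<gamma>)"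
    by (rule linear_extension_superset) (auto simp: Poly_Mapping.keys_add)
  then show "linear_extension F (x + y) = linear_extension F x + linear_extension F y"
    by (simp add: linear_extension_superset[of ?S] lookup_add scaleR_add_left sum.distrib)
  have "linear_extension F (c *\<^sub>R x)
      = (\<Sum>\<gamma>\<in>Poly_Mapping.keys x. Poly_Mapping.lookup (c *\<^sub>R x) \<gamma> *\<^sub>R F \<gamma>)"
    by (rule linear_extension_superset) (auto simp: in_keys_iff lookup_scaleR_poly_mapping)
  then show "linear_extension F (c *\<^sub>R x) = c *\<^sub>R linear_extension F x"
    by (simp add: linear_extension_def lookup_scaleR_poly_mapping scaleR_sum_right)
qed

lemma linear_extension_single [simp]: "linear_extension F (Poly_Mapping.single \<gamma> 1) = F \<gamma>"
  by (simp add: linear_extension_def)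

lemma linear_contraction: "linear (contraction \<tau>)"
  unfolding contraction_def by (rule linear_linear_extension)

lemma linear_contraction_field: "linear (\<lambda>\<tau>. contraction \<tau> x)"
  unfolding contraction_def linear_extension_def[of _ x]
  by (rule linear_compose_sum, rule ballI, rule linear_compose_scale_right)
    (rule linear_linear_extension)

lemma linear_d_H: "linear d_H"
  unfolding d_H_def by (rule linear_linear_extension)

lemma linear_interior_euler: "linear interior_euler"
  unfolding interior_euler_def by (rule linear_linear_extension)

section \<open>Spans of forests\<close>

definition forest_span :: "nat \<Rightarrow> nat \<Rightarrow> form set" where
  "forest_span n p = span ((\<lambda>\<gamma>. Poly_Mapping.single \<gamma> 1) ` forests n p)"

lemma subspace_forest_span: "subspace (forest_span n p)"
  unfolding forest_span_def by (rule subspace_span)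

text \<open>
  The representative is aromatic because the quotient is by a partial equivalence relation
  whose domain consists of the aromatic graphs.
\<close>

lemma forests_cases:
  assumes "\<gamma> \<in> forests n p"
  obtains G where "aromatic_graph G" "\<gamma> = abs_forest G" "Poly_Mapping.single \<gamma> 1 = graph_form G"
    "length (roots G) = n" "length (coverts G) = p"
proof -
  let ?G = "rep_forest \<gamma>"
  have r: "graph_iso ?G ?G" and a: "abs_forest ?G = \<gamma>"
    by (rule Quotient_rep_reflp[OF Quotient_forest]) (rule Quotient_abs_rep[OF Quotient_forest])
  show thesis
    by (rule that[of ?G])
      (use r a assms num_roots.abs_eq[OF r] num_coverts.abs_eq[OF r]
        in \<open>auto simp: graph_iso_def forests_def graph_form_def\<close>)
qed

lemma abs_forest_in_forests:
  "aromatic_graph G \<Longrightarrow> abs_forest G \<in> forests (length (roots G)) (length (coverts G))"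
  using num_roots.abs_eq[OF graph_iso_refl] num_coverts.abs_eq[OF graph_iso_refl]
  by (simp add: forests_def)

lemma graph_form_in_forest_span:
  assumes "aromatic_graph G" "length (roots G) = n" "length (coverts G) = p"
  shows "graph_form G \<in> forest_span n p"
  unfolding forest_span_def graph_form_def
  by (rule span_base, rule imageI) (use abs_forest_in_forests[OF assms(1)] assms(2,3) in simp)

lemma linear_forest_span_into:
  assumes "linear L" "subspace S" "x \<in> forest_span n p"
    and "\<And>\<gamma>. \<gamma> \<in> forests n p \<Longrightarrow> L (Poly_Mapping.single \<gamma> 1) \<in> S"
  shows "L x \<in> S"
proof -
  have "forest_span n p \<subseteq> L -` S"
    unfolding forest_span_def
    by (rule span_minimal) (use assms linear_subspace_vimage in auto)
  with assms(3) show ?thesis by blast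
qed

lemma linear_eq_on_forest_span:
  assumes "linear L" "linear M" "x \<in> forest_span n p"
    and "\<And>\<gamma>. \<gamma> \<in> forests n p \<Longrightarrow> L (Poly_Mapping.single \<gamma> 1) = M (Poly_Mapping.single \<gamma> 1)"
  shows "L x = M x"
  using assms(3) unfolding forest_span_def
  by (rule linear_eq_on_span[OF assms(1,2), rotated]) (use assms(4) in auto)

lemma forest_span_disjoint:
  assumes "x \<in> forest_span n p" "x \<in> forest_span m q" "(n, p) \<noteq> (m, q)"
  shows "x = 0"
proof -
  have keys: "Poly_Mapping.keys y \<subseteq> forests k l" if "y \<in> forest_span k l" for y k l
    using that unfolding forest_span_def
  proof (induction rule: span_induct_alt)
    case (step c z w)
    have "Poly_Mapping.keys (c *\<^sub>R z) \<subseteq> Poly_Mapping.keys z" for c and z :: form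
      by (auto simp: in_keys_iff lookup_scaleR_poly_mapping)
    moreover have "Poly_Mapping.keys z \<subseteq> forests k l"
      using step by auto
    ultimately show ?case
      using step Poly_Mapping.keys_add[of "c *\<^sub>R z" w] by blast
  qed simp
  have "forests n p \<inter> forests m q = {}"
    using assms(3) by (auto simp: forests_def)
  then have "Poly_Mapping.keys x = {}"
    using keys[OF assms(1)] keys[OF assms(2)] by blast
  then show ?thesis by simp
qed

section \<open>Alternation of forms with few roots and covertices\<close>

lemma linear_wedge: "linear wedge"
  using linear_compose[OF linear_linear_extension linear_linear_extension]
  by (simp add: wedge_def[abs_def] o_def)

lemma permutes_lessThan_le_1: "n \<le> 1 \<Longrightarrow> {\<sigma>. \<sigma> permutes {..<n::nat}} = {id}"
  by (cases n) (auto simp: lessThan_Suc)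

text \<open>At most one root and one covertex leave only the identity to alternate over.\<close>

lemma wedge_single_le_1:
  assumes "\<gamma> \<in> forests n p" "n \<le> 1" "p \<le> 1"
  shows "wedge (Poly_Mapping.single \<gamma> 1) = Poly_Mapping.single \<gamma> 1"
proof -
  obtain G where G: "aromatic_graph G" "\<gamma> = abs_forest G" "Poly_Mapping.single \<gamma> 1 = graph_form G"
    "length (roots G) = n" "length (coverts G) = p"
    using forests_cases[OF assms(1)] .
  have le: "length (roots G) \<le> 1" "length (coverts G) \<le> 1" using G assms by auto
  have f: "fact (length (roots G)) = (1::real)" "fact (length (coverts G)) = (1::real)"
    using le by (auto simp: le_Suc_eq)
  have u: "G\<lparr>roots := roots G\<rparr> = G" "G\<lparr>coverts := coverts G\<rparr> = G" by simp_all
  have "wedge_roots_forest \<gamma> = graph_form G" "wedge_coverts_forest \<gamma> = graph_form G"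
    unfolding G(2) wedge_roots_forest.abs_eq[OF graph_iso_refl[OF G(1)]]
      wedge_coverts_forest.abs_eq[OF graph_iso_refl[OF G(1)]]
      permutes_lessThan_le_1[OF le(1)] permutes_lessThan_le_1[OF le(2)]
    by (simp_all add: f u inv_id sign_id del: One_nat_def)
  then show ?thesis by (simp add: wedge_def G(3)[symmetric])
qed

lemma aromatic_forms_le_1:
  assumes "n \<le> 1" "p \<le> 1"
  shows "aromatic_forms n p = forest_span n p"
proof -
  have "wedge x = x" if "x \<in> forest_span n p" for x
    using linear_eq_on_forest_span[OF linear_wedge linear_id that]
      wedge_single_le_1[OF _ assms] by simp
  then show ?thesis by (simp add: aromatic_forms_def forest_span_def)
qed

lemma aromatic_forms_subset: "aromatic_forms n p \<subseteq> forest_span n p"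
proof -
  have c: "wedge_coverts_forest \<gamma> \<in> forest_span n p" if \<gamma>: "\<gamma> \<in> forests n p" for \<gamma>
  proof -
    obtain G where G: "aromatic_graph G" "\<gamma> = abs_forest G"
      "length (roots G) = n" "length (coverts G) = p"
      using forests_cases[OF \<gamma>] .
    show ?thesis
      unfolding G(2) wedge_coverts_forest.abs_eq[OF graph_iso_refl[OF G(1)]]
      by (intro subspace_scale subspace_sum subspace_forest_span graph_form_in_forest_span)
        (use G in \<open>auto simp: aromatic_graph_def permutes_inv\<close>)
  qed
  have r: "wedge_roots_forest \<gamma> \<in> forest_span n p" if \<gamma>: "\<gamma> \<in> forests n p" for \<gamma>
  proof -
    obtain G where G: "aromatic_graph G" "\<gamma> = abs_forest G"
      "length (roots G) = n" "length (coverts G) = p"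
      using forests_cases[OF \<gamma>] .
    show ?thesis
      unfolding G(2) wedge_roots_forest.abs_eq[OF graph_iso_refl[OF G(1)]]
      by (intro subspace_scale subspace_sum subspace_forest_span graph_form_in_forest_span)
        (use G in \<open>auto simp: aromatic_graph_def permutes_inv\<close>)
  qed
  note into = linear_forest_span_into
    [OF linear_linear_extension subspace_forest_span[of n p], where n = n and p = p]
  have "wedge x \<in> forest_span n p" if "x \<in> forest_span n p" for x
    unfolding wedge_def
    by (rule into[OF into[OF that]]) (simp_all add: c r)
  then show ?thesis by (auto simp: aromatic_forms_def forest_span_def)
qed

section \<open>Redirecting edges\<close>

text \<open>
  The common form of the graphs that occur in contractions, in \<open>d\<^sub>H\<close> and in \<open>I\<close>: those in one
  sum differ only in the targets of the edges that leave \<open>Q\<close>.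
\<close>

definition rewire :: "'a set \<Rightarrow> ('a \<Rightarrow> 'a) \<Rightarrow> 'a graph \<Rightarrow> 'a graph" where
  "rewire Q \<chi> K = K\<lparr>edges := {(s, t). if s \<in> Q then t = \<chi> s else (s, t) \<in> edges K}\<rparr>"

lemma rewire_simps [simp]:
  "nodes (rewire Q \<chi> K) = nodes K"
  "coverts (rewire Q \<chi> K) = coverts K"
  "roots (rewire Q \<chi> K) = roots K"
  "(s, t) \<in> edges (rewire Q \<chi> K) \<longleftrightarrow> (if s \<in> Q then t = \<chi> s else (s, t) \<in> edges K)"
  by (simp_all add: rewire_def)

lemma aromatic_graph_rewire:
  assumes "aromatic_graph K" "Q \<subseteq> nodes K - set (roots K)" "\<chi> \<in> Q \<rightarrow> nodes K"
  shows "aromatic_graph (rewire Q \<chi> K)"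
  unfolding aromatic_graph_def rewire_simps
proof (intro conjI ballI)
  show "edges (rewire Q \<chi> K) \<subseteq> nodes K \<times> nodes K"
    using assms edge_in_nodes[OF assms(1)] by (auto split: if_splits)
next
  fix v assume "v \<in> nodes K - set (roots K)"
  then show "\<exists>!w. if v \<in> Q then w = \<chi> v else (v, w) \<in> edges K"
    using assms(1) by (cases "v \<in> Q") (simp_all add: aromatic_graph_def)
qed (use assms in \<open>auto simp: aromatic_graph_def\<close>)

lemma rewire_rewire_single:
  "v \<in> Q \<Longrightarrow> rewire {v} (\<lambda>_. u) (rewire Q \<chi> K) = rewire Q (\<chi>(v := u)) K"
  by (rule graph.equality) (auto simp: rewire_def)

text \<open>The new root is numbered last, because \<open>d_H\<close> plugs the last root.\<close>

definition uproot :: "'a \<Rightarrow> 'a graph \<Rightarrow> 'a graph" where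
  "uproot v K = K\<lparr>edges := {(s, t) \<in> edges K. s \<noteq> v}, roots := roots K @ [v]\<rparr>"

lemma aromatic_graph_uproot:
  assumes "aromatic_graph K" "v \<in> nodes K - set (roots K)"
  shows "aromatic_graph (uproot v K)"
  using assms by (auto simp: aromatic_graph_def uproot_def)

lemma add_root_edge_uproot:
  "v \<notin> set (roots K) \<Longrightarrow> add_root_edge v u (uproot v K) = rewire {v} (\<lambda>_. u) K"
  by (rule graph.equality) (auto simp: add_root_edge_def uproot_def rewire_def remove1_append)

lemma d_H_graph_form:
  assumes "aromatic_graph G" "roots G \<noteq> []"
  shows "d_H (graph_form G) = (\<Sum>u\<in>nodes G. graph_form (add_root_edge (last (roots G)) u G))"
  using d_H_forest.abs_eq[OF graph_iso_refl[OF assms(1)]] assms(2)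
  by (simp add: d_H_def graph_form_def)

text \<open>
  Making \<open>v\<close> a root and then applying \<open>d_H\<close> redirects the edge that left \<open>v\<close> in all possible
  ways.  The renaming \<open>e\<close> serves graphs whose nodes are not natural numbers.
\<close>

lemma d_H_uproot:
  assumes K: "aromatic_graph K" "v \<in> nodes K - set (roots K)" and e: "inj_on e (nodes K)"
  shows "d_H (graph_form (relabel e (uproot v K)))
    = (\<Sum>u\<in>nodes K. graph_form (relabel e (rewire {v} (\<lambda>_. u) K)))"
proof -
  let ?L = "uproot v K"
  have L: "aromatic_graph ?L" using aromatic_graph_uproot[OF K] .
  have n: "nodes ?L = nodes K" and r: "roots ?L = roots K @ [v]" by (simp_all add: uproot_def)
  have eL: "inj_on e (nodes ?L)" using e n by simp
  have "relabel e (rewire {v} (\<lambda>_. u) K) = add_root_edge (e v) (e u) (relabel e ?L)" for u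
    using relabel_add_root_edge[OF L _ eL, of v u] K(2) r by (simp add: add_root_edge_uproot)
  then show ?thesis
    using d_H_graph_form[OF aromatic_graph_relabel[OF L eL]] e
    by (simp add: n r sum.reindex)
qed

section \<open>Summation by parts\<close>

lemma sum_PiE_insert:
  assumes "x \<notin> P"
  shows "(\<Sum>\<phi>\<in>insert x P \<rightarrow>\<^sub>E A. F \<phi>) = (\<Sum>\<phi>\<in>P \<rightarrow>\<^sub>E A. \<Sum>u\<in>A. F (\<phi>(x := u)))"
proof -
  have "(\<Sum>\<phi>\<in>insert x P \<rightarrow>\<^sub>E A. F \<phi>) = (\<Sum>(u, \<phi>)\<in>A \<times> (P \<rightarrow>\<^sub>E A). F (\<phi>(x := u)))"
    unfolding PiE_insert_eq
    by (subst sum.reindex[OF inj_combinator[OF assms]]) (simp add: case_prod_unfold)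
  also have "\<dots> = (\<Sum>u\<in>A. \<Sum>\<phi>\<in>P \<rightarrow>\<^sub>E A. F (\<phi>(x := u)))"
    by (rule sum.cartesian_product[symmetric])
  finally show ?thesis by (simp add: sum.swap[of _ A])
qed

text \<open>
  Modulo \<open>W\<close>, the sum over the values of \<open>\<phi>\<close> at one point in \<open>B\<close> is the opposite of the sum over
  its values there in \<open>A\<close>, so replacing \<open>B\<close> by \<open>A\<close> at all points of \<open>P\<close> costs \<open>(-1)\<^bsup>|P|\<^esup>\<close>.
\<close>

lemma alternating_summation_by_parts:
  fixes F :: "('a \<Rightarrow> 'b) \<Rightarrow> 'c::real_vector"
  assumes W: "subspace W" and "finite P" and AB: "finite A" "finite B" "A \<inter> B = {}"
    and "\<And>\<phi> v. \<phi> \<in> P \<rightarrow> A \<union> B \<Longrightarrow> v \<in> P \<Longrightarrow> (\<Sum>u\<in>A \<union> B. F (\<phi>(v := u))) \<in> W"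
  shows "(\<Sum>\<phi>\<in>P \<rightarrow>\<^sub>E B. F \<phi>) - (-1) ^ card P *\<^sub>R (\<Sum>\<phi>\<in>P \<rightarrow>\<^sub>E A. F \<phi>) \<in> W"
  using assms(2,6)
proof (induction P arbitrary: F rule: finite_induct)
  case empty
  then show ?case using W by (simp add: subspace_0)
next
  case (insert x P)
  \<comment> \<open>The value at \<open>x\<close> stays in \<open>B\<close> while the induction hypothesis moves the others.\<close>
  define F' where "F' \<phi> = (\<Sum>u\<in>B. F (\<phi>(x := u)))" for \<phi>
  have "(\<Sum>u\<in>A \<union> B. F' (\<phi>(v := u))) \<in> W" if \<phi>: "\<phi> \<in> P \<rightarrow> A \<union> B" and v: "v \<in> P" for \<phi> v
  proof -
    have "x \<noteq> v" using v insert.hyps by blast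
    then have "(\<Sum>u\<in>A \<union> B. F' (\<phi>(v := u))) = (\<Sum>w\<in>B. \<Sum>u\<in>A \<union> B. F ((\<phi>(x := w))(v := u)))"
      unfolding F'_def by (subst sum.swap) (simp add: fun_upd_twist)
    also have "\<dots> \<in> W"
      by (rule subspace_sum[OF W], rule insert.prems) (use \<phi> v in \<open>auto simp: Pi_iff\<close>)
    finally show ?thesis .
  qed
  then have 1: "(\<Sum>\<phi>\<in>P \<rightarrow>\<^sub>E B. F' \<phi>) - (-1) ^ card P *\<^sub>R (\<Sum>\<phi>\<in>P \<rightarrow>\<^sub>E A. F' \<phi>) \<in> W"
    by (rule insert.IH)
  \<comment> \<open>The value at \<open>x\<close> is moved last.\<close>
  have 2: "(\<Sum>\<phi>\<in>P \<rightarrow>\<^sub>E A. \<Sum>u\<in>A \<union> B. F (\<phi>(x := u))) \<in> W"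
  proof (rule subspace_sum[OF W])
    fix \<phi> assume "\<phi> \<in> P \<rightarrow>\<^sub>E A"
    show "(\<Sum>u\<in>A \<union> B. F (\<phi>(x := u))) \<in> W"
    proof (cases "A \<union> B = {}")
      case True
      then show ?thesis using W by (simp add: subspace_0)
    next
      case False
      then obtain w where "w \<in> A \<union> B" by blast
      then have "\<phi>(x := w) \<in> insert x P \<rightarrow> A \<union> B"
        using \<open>\<phi> \<in> P \<rightarrow>\<^sub>E A\<close> by auto
      from insert.prems[OF this, of x] show ?thesis by (simp add: fun_upd_def cong: if_cong)
    qed
  qed
  have "(\<Sum>\<phi>\<in>P \<rightarrow>\<^sub>E A. \<Sum>u\<in>A \<union> B. F (\<phi>(x := u)))
      = (\<Sum>\<phi>\<in>insert x P \<rightarrow>\<^sub>E A. F \<phi>) + (\<Sum>\<phi>\<in>P \<rightarrow>\<^sub>E A. F' \<phi>)"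
    using AB insert.hyps by (simp add: F'_def sum.union_disjoint sum.distrib sum_PiE_insert)
  moreover have "(\<Sum>\<phi>\<in>insert x P \<rightarrow>\<^sub>E B. F \<phi>) = (\<Sum>\<phi>\<in>P \<rightarrow>\<^sub>E B. F' \<phi>)"
    unfolding F'_def using insert.hyps by (simp add: sum_PiE_insert)
  ultimately show ?case
    using subspace_add[OF W 1 subspace_scale[OF W 2, of "(-1) ^ card P"]] insert.hyps
    by (simp add: scaleR_add_right algebra_simps)
qed

section \<open>Contraction of the interior Euler operator\<close>

definition divergences :: "form set" where
  "divergences = d_H ` forest_span 1 0"

lemma subspace_divergences: "subspace divergences"
  unfolding divergences_def by (rule linear_subspace_image[OF linear_d_H subspace_forest_span])

text \<open>The hypothesis of \<open>alternating_summation_by_parts\<close>: the sum is \<open>d_H\<close> of a graph with root \<open>v\<close>.\<close>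

lemma sum_rewire_divergence:
  assumes K: "aromatic_graph K" "roots K = []" "coverts K = []" and e: "inj_on e (nodes K)"
    and Q: "Q \<subseteq> nodes K" "\<chi> \<in> Q \<rightarrow> nodes K" "v \<in> Q"
  shows "(\<Sum>u\<in>nodes K. graph_form (relabel e (rewire Q (\<chi>(v := u)) K))) \<in> divergences"
proof -
  let ?R = "rewire Q \<chi> K"
  have R: "aromatic_graph ?R" using aromatic_graph_rewire[OF K(1), of Q \<chi>] Q K(2) by simp
  have v: "v \<in> nodes ?R - set (roots ?R)" using Q K(2) by auto
  have i: "inj_on e (nodes ?R)" using e by simp
  have U: "aromatic_graph (relabel e (uproot v ?R))"
    by (rule aromatic_graph_relabel[OF aromatic_graph_uproot[OF R v]]) (use e in \<open>simp add: uproot_def\<close>)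
  have "graph_form (relabel e (uproot v ?R)) \<in> forest_span 1 0"
    by (rule graph_form_in_forest_span[OF U]) (simp_all add: uproot_def K)
  moreover have "(\<Sum>u\<in>nodes K. graph_form (relabel e (rewire Q (\<chi>(v := u)) K)))
      = d_H (graph_form (relabel e (uproot v ?R)))"
    using d_H_uproot[OF R v i] Q(3) by (simp add: rewire_rewire_single)
  ultimately show ?thesis unfolding divergences_def by (rule rev_image_eqI)
qed

text \<open>
  The node of \<open>substitute c \<phi> T G\<close> that carries the outgoing edge of \<open>v\<close>: the root \<open>r\<close> of \<open>T\<close>
  takes over that of \<open>c\<close>.
\<close>

definition stem :: "'a \<Rightarrow> 'b \<Rightarrow> 'a \<Rightarrow> 'a + 'b" where
  "stem c r v = (if v = c then Inr r else Inl v)"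

lemma inj_stem: "inj (stem c r)"
  by (auto simp: inj_def stem_def)

lemma edges_substitute:
  assumes "roots T = [r]"
  shows "(s, t) \<in> edges (substitute c \<phi> T G) \<longleftrightarrow>
    (\<exists>v w. (v, w) \<in> edges G \<and> s = stem c r v \<and> t = (if w = c then Inr (\<phi> v) else Inl w)) \<or>
    (\<exists>x y. (x, y) \<in> edges T \<and> s = Inr x \<and> t = Inr y)"
proof -
  have "(s, t) \<in> edges (substitute c \<phi> T G) \<longleftrightarrow>
    (\<exists>v w. (v, w) \<in> edges G \<and> w \<noteq> c \<and> s = stem c r v \<and> t = Inl w) \<or>
    (\<exists>v. (v, c) \<in> edges G \<and> s = stem c r v \<and> t = Inr (\<phi> v)) \<or>
    (\<exists>x y. (x, y) \<in> edges T \<and> s = Inr x \<and> t = Inr y)"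
    unfolding substitute_def Let_def assms list.sel stem_def[symmetric] preds_def by auto
  moreover have "t = (if w = c then Inr (\<phi> v) else Inl w)
      \<longleftrightarrow> w = c \<and> t = Inr (\<phi> v) \<or> w \<noteq> c \<and> t = Inl w" for v w
    by simp
  ultimately show ?thesis by (simp only:) blast
qed

text \<open>
  The substitution that grafts all predecessors of \<open>c\<close> onto the root of \<open>T\<close> serves as a common
  reference: redirecting the edges that leave these predecessors yields the graphs of
  \<open>i\<^sub>\<tau> G\<close> if they end in \<open>T\<close> (\<open>substitute_eq_rewire\<close>) and those of \<open>i\<^sub>\<tau> (I G)\<close> if they end in \<open>G\<close>
  (\<open>substitute_replug_eq_rewire\<close>).
\<close>

lemma rewire_substitute_eqI:
  assumes G: "aromatic_graph G" and T: "aromatic_graph T" "roots T = [r]"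
    and S: "nodes S = nodes (substitute c (\<lambda>_. r) T G)"
      "coverts S = coverts (substitute c (\<lambda>_. r) T G)"
      "roots S = roots (substitute c (\<lambda>_. r) T G)"
    and E: "\<And>s t. (s, t) \<in> edges S \<longleftrightarrow>
      (\<exists>v w. (v, w) \<in> edges G \<and> s = stem c r v \<and> t = (if w = c then \<chi> s else Inl w)) \<or>
      (\<exists>x y. (x, y) \<in> edges T \<and> s = Inr x \<and> t = Inr y)"
  shows "S = rewire (stem c r ` preds G c) \<chi> (substitute c (\<lambda>_. r) T G)"
proof -
  have r: "(r, y) \<notin> edges T" for y using T by (auto simp: aromatic_graph_def)
  have c: "w = c" if "v \<in> preds G c" "(v, w) \<in> edges G" for v w
  proof -
    have "v \<in> nodes G" "v \<notin> set (roots G)"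
      using that G by (auto simp: aromatic_graph_def)
    then have "\<exists>!w. (v, w) \<in> edges G" using G by (auto simp: aromatic_graph_def)
    with that show ?thesis by (auto simp: preds_def)
  qed
  have "(s, t) \<in> edges S
      \<longleftrightarrow> (s, t) \<in> edges (rewire (stem c r ` preds G c) \<chi> (substitute c (\<lambda>_. r) T G))" for s t
  proof (cases "s \<in> stem c r ` preds G c")
    case True
    then obtain v where v: "v \<in> preds G c" "s = stem c r v" by blast
    have "s \<noteq> Inr x" if "(x, y) \<in> edges T" for x y
      using v that r by (auto simp: stem_def)
    moreover have "(v, c) \<in> edges G" using v by (simp add: preds_def)
    moreover have "w = c" if "(v', w) \<in> edges G" "s = stem c r v'" for v' w
      using c[OF v(1)] that v(2) injD[OF inj_stem[of c r]] by metis
    ultimately have "(s, t) \<in> edges S \<longleftrightarrow> t = \<chi> s"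
      unfolding E using v(2) by metis
    then show ?thesis using True by simp
  next
    case False
    then have "w \<noteq> c" if "(v, w) \<in> edges G" "s = stem c r v" for v w
      using that by (auto simp: preds_def)
    then show ?thesis
      using False unfolding E rewire_simps edges_substitute[OF T(2)] by auto
  qed
  then have "edges S = edges (rewire (stem c r ` preds G c) \<chi> (substitute c (\<lambda>_. r) T G))"
    by (intro set_eqI) (metis surj_pair)
  with S show ?thesis by (intro graph.equality) simp_all
qed

lemma substitute_eq_rewire:
  assumes G: "aromatic_graph G" and T: "aromatic_graph T" "roots T = [r]"
    and chi: "\<And>v. v \<in> preds G c \<Longrightarrow> \<chi> (stem c r v) = Inr (\<phi> v)"
  shows "substitute c \<phi> T G
    = rewire (stem c r ` preds G c) \<chi> (substitute c (\<lambda>_. r) T G)"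
proof (rule rewire_substitute_eqI[OF G T])
  fix s t
  show "(s, t) \<in> edges (substitute c \<phi> T G) \<longleftrightarrow>
    (\<exists>v w. (v, w) \<in> edges G \<and> s = stem c r v \<and> t = (if w = c then \<chi> s else Inl w)) \<or>
    (\<exists>x y. (x, y) \<in> edges T \<and> s = Inr x \<and> t = Inr y)"
    unfolding edges_substitute[OF T(2)]
    by (intro arg_cong2[of _ _ _ _ "(\<or>)"] refl ex_cong1) (auto simp: chi preds_def)
qed (simp_all add: substitute_def Let_def)

lemma preds_replug:
  assumes "\<And>v. v \<in> preds G c \<Longrightarrow> \<psi> v \<noteq> c"
  shows "preds (replug c \<psi> G) c = {}"
  using assms by (auto simp: preds_def replug_def)

text \<open>
  Replugging leaves \<open>c\<close> without predecessors, so the grafting map \<open>\<phi>\<close> is arbitrary here.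
\<close>

lemma substitute_replug_eq_rewire:
  assumes G: "aromatic_graph G" and T: "aromatic_graph T" "roots T = [r]"
    and psi: "\<And>v. v \<in> preds G c \<Longrightarrow> \<psi> v \<noteq> c"
    and chi: "\<And>v. v \<in> preds G c \<Longrightarrow> \<chi> (stem c r v) = Inl (\<psi> v)"
  shows "substitute c \<phi> T (replug c \<psi> G)
    = rewire (stem c r ` preds G c) \<chi> (substitute c (\<lambda>_. r) T G)"
proof (rule rewire_substitute_eqI[OF G T])
  fix s t
  have e: "(v, w) \<in> edges (replug c \<psi> G)
      \<longleftrightarrow> (\<exists>w'. (v, w') \<in> edges G \<and> w = (if w' = c then \<psi> v else w'))" for v w
    by (auto simp: replug_def preds_def)
  have "(\<exists>v w. (v, w) \<in> edges (replug c \<psi> G) \<and> s = stem c r v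
        \<and> t = (if w = c then Inr (\<phi> v) else Inl w))
    \<longleftrightarrow> (\<exists>v w. (v, w) \<in> edges G \<and> s = stem c r v \<and> t = (if w = c then \<chi> s else Inl w))"
    (is "?L \<longleftrightarrow> ?R")
  proof
    assume ?L
    then obtain v w w' where "(v, w') \<in> edges G" "w = (if w' = c then \<psi> v else w')"
      "s = stem c r v" "t = (if w = c then Inr (\<phi> v) else Inl w)"
      unfolding e by blast
    then show ?R
      using psi[of v] chi[of v] by (intro exI[of _ v] exI[of _ w']) (auto simp: preds_def)
  next
    assume ?R
    then obtain v w where vw: "(v, w) \<in> edges G" "s = stem c r v"
      "t = (if w = c then \<chi> s else Inl w)" by blast
    define u where "u = (if w = c then \<psi> v else w)"
    have "t = (if u = c then Inr (\<phi> v) else Inl u)"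
      using vw psi[of v] chi[of v] by (auto simp: u_def preds_def)
    moreover have "(v, u) \<in> edges (replug c \<psi> G)"
      unfolding e using vw(1) u_def by blast
    ultimately show ?L using vw(2) by blast
  qed
  then show "(s, t) \<in> edges (substitute c \<phi> T (replug c \<psi> G)) \<longleftrightarrow>
    (\<exists>v w. (v, w) \<in> edges G \<and> s = stem c r v \<and> t = (if w = c then \<chi> s else Inl w)) \<or>
    (\<exists>x y. (x, y) \<in> edges T \<and> s = Inr x \<and> t = Inr y)"
    unfolding edges_substitute[OF T(2)] by simp
qed (simp_all add: substitute_def Let_def replug_def)

lemma contraction_graph_form:
  assumes T: "aromatic_graph T" "length (roots T) = 1" "coverts T = []"
    and G: "aromatic_graph G" "coverts G = [c]"
  shows "contraction (graph_form T) (graph_form G)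
    = (\<Sum>\<phi>\<in>preds G c \<rightarrow>\<^sub>E nodes T. graph_form (relabel sum_encode (substitute c \<phi> T G)))"
  using num_coverts.abs_eq[OF graph_iso_refl[OF G(1)]]
    subst_last.abs_eq[OF graph_iso_refl[OF T(1)] graph_iso_refl[OF G(1)]]
  by (simp add: contraction_def graph_form_def T G)

lemma contraction_in_forest_span:
  assumes \<tau>: "\<tau> \<in> forest_span 1 0" and x: "x \<in> forest_span n 1"
  shows "contraction \<tau> x \<in> forest_span n 0"
proof (rule linear_forest_span_into[OF linear_contraction_field subspace_forest_span \<tau>])
  fix t assume t: "t \<in> forests 1 0"
  show "contraction (Poly_Mapping.single t 1) x \<in> forest_span n 0"
  proof (rule linear_forest_span_into[OF linear_contraction subspace_forest_span x])
    fix g assume g: "g \<in> forests n 1"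
    obtain T where T: "aromatic_graph T" "Poly_Mapping.single t 1 = graph_form T"
      "length (roots T) = 1" "length (coverts T) = 0"
      using forests_cases[OF t] .
    obtain G where G: "aromatic_graph G" "Poly_Mapping.single g 1 = graph_form G"
      "length (roots G) = n" "length (coverts G) = 1"
      using forests_cases[OF g] .
    obtain r c where rc: "roots T = [r]" "coverts G = [c]"
      using T(3) G(4) by (auto simp: length_Suc_conv)
    have cT: "coverts T = []" using T(4) by simp
    have S: "aromatic_graph (relabel sum_encode (substitute c \<phi> T G))"
      if "\<phi> \<in> preds G c \<rightarrow>\<^sub>E nodes T" for \<phi>
      using that rc(2)
      by (intro aromatic_graph_relabel aromatic_graph_substitute[OF G(1) _ T(1) rc(1)]
          inj_on_subset[OF inj_sum_encode]) auto
    show "contraction (Poly_Mapping.single t 1) (Poly_Mapping.single g 1) \<in> forest_span n 0"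
      unfolding T(2) G(2) contraction_graph_form[OF T(1,3) cT G(1) rc(2)]
      by (intro subspace_sum[OF subspace_forest_span] graph_form_in_forest_span[OF S])
        (use G rc in \<open>simp_all add: substitute_def Let_def\<close>)
  qed
qed

lemma interior_euler_graph_form:
  assumes G: "aromatic_graph G" "roots G = []" "coverts G = [c]"
  shows "interior_euler (graph_form G) = (-1) ^ card (preds G c) *\<^sub>R
    (\<Sum>\<psi>\<in>preds G c \<rightarrow>\<^sub>E vertices G. graph_form (replug c \<psi> G))"
  using euler_forest.abs_eq[OF graph_iso_refl[OF G(1)]]
  by (simp add: interior_euler_def graph_form_def G Let_def)

text \<open>
  Both contractions are rewritten as sums over maps from the stems of \<open>P\<close> into the nodes of one
  graph \<open>K\<close>, where summation by parts applies.
\<close>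

lemma contraction_interior_euler_graph:
  assumes T: "aromatic_graph T" "roots T = [r]" "coverts T = []"
    and G: "aromatic_graph G" "roots G = []" "coverts G = [c]"
  shows "contraction (graph_form T) (graph_form G - interior_euler (graph_form G)) \<in> divergences"
proof -
  define P where "P = preds G c"
  define K where "K = substitute c (\<lambda>_. r) T G"
  define F where "F \<chi> = graph_form (relabel sum_encode (rewire (stem c r ` P) \<chi> K))" for \<chi>
  let ?A = "Inl ` vertices G" and ?B = "Inr ` nodes T"
  have c: "c \<in> set (coverts G)" "c \<in> nodes G" using G by (auto simp: aromatic_graph_def)
  have P: "P \<subseteq> nodes G" using edge_in_nodes[OF G(1)] by (auto simp: P_def preds_def)
  have fin: "finite (nodes G)" "finite (nodes T)" using G T by (auto simp: aromatic_graph_def)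
  have r: "r \<in> nodes T" using T by (auto simp: aromatic_graph_def)
  have lT: "length (roots T) = 1" using T(2) by simp
  have aK: "aromatic_graph K"
    unfolding K_def by (rule aromatic_graph_substitute[OF G(1) c(1) T(1,2)]) (simp add: r)
  have K: "nodes K = ?A \<union> ?B" "roots K = []" "coverts K = []"
    using G by (auto simp: K_def substitute_def Let_def vertices_def Plus_def)
  have Q: "stem c r ` P \<subseteq> nodes K"
    unfolding K(1) using P r G(3) by (auto simp: stem_def vertices_def)
  have inj: "inj_on (stem c r) P" "inj_on Inl (vertices G)" "inj_on Inr (nodes T)"
    using inj_on_subset[OF inj_stem] by auto
  have "contraction (graph_form T) (graph_form G)
      = (\<Sum>\<phi>\<in>P \<rightarrow>\<^sub>E nodes T. F (\<lambda>s\<in>stem c r ` P. Inr (\<phi> (inv_into P (stem c r) s))))"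
    unfolding contraction_graph_form[OF T(1) lT T(3) G(1,3)] P_def[symmetric] F_def K_def
  proof (rule sum.cong[OF refl])
    fix \<phi> :: "nat \<Rightarrow> nat"
    let ?\<chi> = "\<lambda>s\<in>stem c r ` P. Inr (\<phi> (inv_into P (stem c r) s))"
    have "substitute c \<phi> T G = rewire (stem c r ` P) ?\<chi> (substitute c (\<lambda>_. r) T G)"
      unfolding P_def by (rule substitute_eq_rewire[OF G(1) T(1,2)]) (simp add: inj[unfolded P_def])
    then show "graph_form (relabel sum_encode (substitute c \<phi> T G))
      = graph_form (relabel sum_encode (rewire (stem c r ` P) ?\<chi> (substitute c (\<lambda>_. r) T G)))"
      by simp
  qed
  also have "\<dots> = (\<Sum>\<chi>\<in>stem c r ` P \<rightarrow>\<^sub>E ?B. F \<chi>)"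
    by (rule sum.reindex_bij_betw[OF bij_betw_PiE_relabel[OF inj(1,3)]])
  finally have 1: "contraction (graph_form T) (graph_form G) = (\<Sum>\<chi>\<in>stem c r ` P \<rightarrow>\<^sub>E ?B. F \<chi>)" .
  have "contraction (graph_form T) (graph_form (replug c \<psi> G))
      = F (\<lambda>s\<in>stem c r ` P. Inl (\<psi> (inv_into P (stem c r) s)))" if "\<psi> \<in> P \<rightarrow>\<^sub>E vertices G" for \<psi>
  proof -
    have \<psi>: "\<psi> v \<noteq> c" if "v \<in> preds G c" for v
      using \<open>\<psi> \<in> P \<rightarrow>\<^sub>E vertices G\<close> that G(3) by (auto simp: P_def vertices_def)
    have R: "aromatic_graph (replug c \<psi> G)"
      by (rule aromatic_graph_replug[OF G(1)]) (use that in \<open>auto simp: P_def vertices_def\<close>)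
    have "coverts (replug c \<psi> G) = [c]" using G(3) by (simp add: replug_def)
    from contraction_graph_form[OF T(1) lT T(3) R this]
    have "contraction (graph_form T) (graph_form (replug c \<psi> G))
      = graph_form (relabel sum_encode (substitute c (\<lambda>_. undefined) T (replug c \<psi> G)))"
      by (simp add: preds_replug[OF \<psi>])
    also have "\<dots> = F (\<lambda>s\<in>stem c r ` P. Inl (\<psi> (inv_into P (stem c r) s)))"
      unfolding F_def K_def P_def
      by (subst substitute_replug_eq_rewire[OF G(1) T(1,2) \<psi>]) (simp_all add: inj[unfolded P_def])
    finally show ?thesis .
  qed
  then have "contraction (graph_form T) (interior_euler (graph_form G))
      = (-1) ^ card P *\<^sub>R (\<Sum>\<psi>\<in>P \<rightarrow>\<^sub>E vertices G. F (\<lambda>s\<in>stem c r ` P. Inl (\<psi> (inv_into P (stem c r) s))))"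
    unfolding interior_euler_graph_form[OF G] P_def[symmetric]
    by (simp add: linear_scale[OF linear_contraction] linear_sum[OF linear_contraction])
  also have "(\<Sum>\<psi>\<in>P \<rightarrow>\<^sub>E vertices G. F (\<lambda>s\<in>stem c r ` P. Inl (\<psi> (inv_into P (stem c r) s))))
      = (\<Sum>\<chi>\<in>stem c r ` P \<rightarrow>\<^sub>E ?A. F \<chi>)"
    by (rule sum.reindex_bij_betw[OF bij_betw_PiE_relabel[OF inj(1,2)]])
  also have "card P = card (stem c r ` P)" by (simp add: card_image inj)
  finally have 2: "contraction (graph_form T) (interior_euler (graph_form G))
      = (-1) ^ card (stem c r ` P) *\<^sub>R (\<Sum>\<chi>\<in>stem c r ` P \<rightarrow>\<^sub>E ?A. F \<chi>)" .
  show ?thesis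
    unfolding linear_diff[OF linear_contraction] 1 2
  proof (rule alternating_summation_by_parts[OF subspace_divergences])
    show "finite (stem c r ` P)" using P fin finite_subset by blast
    show "finite ?A" "finite ?B" "?A \<inter> ?B = {}" using fin by (auto simp: vertices_def)
    fix \<chi> v assume "\<chi> \<in> stem c r ` P \<rightarrow> ?A \<union> ?B" "v \<in> stem c r ` P"
    then show "(\<Sum>u\<in>?A \<union> ?B. F (\<chi>(v := u))) \<in> divergences"
      using sum_rewire_divergence[OF aK K(2,3) inj_on_subset[OF inj_sum_encode subset_UNIV] Q, of \<chi> v]
      unfolding F_def K(1) by blast
  qed
qed

lemma contraction_interior_euler:
  assumes \<tau>: "\<tau> \<in> forest_span 1 0" and x: "x \<in> forest_span 0 1"
  shows "contraction \<tau> x - contraction \<tau> (interior_euler x) \<in> divergences"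
proof (rule linear_forest_span_into[OF _ subspace_divergences \<tau>])
  show "linear (\<lambda>\<tau>. contraction \<tau> x - contraction \<tau> (interior_euler x))"
    by (rule linear_compose_sub[OF linear_contraction_field linear_contraction_field])
next
  fix t assume t: "t \<in> forests 1 0"
  let ?t = "Poly_Mapping.single t 1 :: form"
  show "contraction ?t x - contraction ?t (interior_euler x) \<in> divergences"
  proof (rule linear_forest_span_into[OF _ subspace_divergences x])
    show "linear (\<lambda>x. contraction ?t x - contraction ?t (interior_euler x))"
      by (rule linear_compose_sub[OF linear_contraction
            linear_compose[OF linear_interior_euler linear_contraction, unfolded o_def]])
  next
    fix g assume g: "g \<in> forests 0 1"
    obtain T where T: "aromatic_graph T" "?t = graph_form T" "length (roots T) = 1"
      "length (coverts T) = 0"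
      using forests_cases[OF t] .
    obtain G where G: "aromatic_graph G" "Poly_Mapping.single g 1 = graph_form G"
      "length (roots G) = 0" "length (coverts G) = 1"
      using forests_cases[OF g] .
    obtain r c where rc: "roots T = [r]" "coverts G = [c]"
      using T(3) G(4) by (auto simp: length_Suc_conv)
    have "coverts T = []" "roots G = []" using T G by simp_all
    from contraction_interior_euler_graph[OF T(1) rc(1) this(1) G(1) this(2) rc(2)]
    show "contraction ?t (Poly_Mapping.single g 1)
        - contraction ?t (interior_euler (Poly_Mapping.single g 1)) \<in> divergences"
      unfolding T(2) G(2) linear_diff[OF linear_contraction] .
  qed
qed

section \<open>Divergence symmetries and conservation laws\<close>

lemma d_V_in_forest_span:
  assumes "\<gamma> \<in> forest_span 0 0"
  shows "d_V \<gamma> \<in> forest_span 0 1"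
  unfolding d_V_def
proof (rule linear_forest_span_into[OF linear_linear_extension subspace_forest_span assms])
  fix g assume "g \<in> forests 0 0"
  then obtain G where G: "aromatic_graph G" "g = abs_forest G" "roots G = []" "coverts G = []"
    by (auto elim: forests_cases)
  have "covert_sum g \<in> forest_span 0 1"
    unfolding G(2) covert_sum.abs_eq[OF graph_iso_refl[OF G(1)]]
  proof (rule subspace_sum[OF subspace_forest_span])
    fix v assume "v \<in> vertices G"
    with G have "aromatic_graph (make_covert v G)"
      by (auto simp: aromatic_graph_def make_covert_def vertices_def)
    then show "graph_form (make_covert v G) \<in> forest_span 0 1"
      by (rule graph_form_in_forest_span) (simp_all add: make_covert_def G)
  qed
  then have "wedge (covert_sum g) \<in> aromatic_forms 0 1"
    unfolding aromatic_forms_def forest_span_def by (rule imageI)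
  then show "linear_extension (\<lambda>\<gamma>. wedge (covert_sum \<gamma>)) (Poly_Mapping.single g 1)
      \<in> forest_span 0 1"
    by (simp add: aromatic_forms_le_1)
qed

lemma d_H_in_forest_span:
  assumes "\<eta> \<in> forest_span (Suc n) p"
  shows "d_H \<eta> \<in> forest_span n p"
proof (rule linear_forest_span_into[OF linear_d_H subspace_forest_span assms])
  fix g assume "g \<in> forests (Suc n) p"
  then obtain G where G: "aromatic_graph G" "Poly_Mapping.single g 1 = graph_form G"
    "length (roots G) = Suc n" "length (coverts G) = p"
    by (elim forests_cases)
  have ne: "roots G \<noteq> []" using G by auto
  show "d_H (Poly_Mapping.single g 1) \<in> forest_span n p"
    unfolding G(2) d_H_graph_form[OF G(1) ne]
  proof (rule subspace_sum[OF subspace_forest_span])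
    fix u assume "u \<in> nodes G"
    then have "aromatic_graph (add_root_edge (last (roots G)) u G)"
      using aromatic_graph_add_root_edge[OF G(1)] ne by simp
    then show "graph_form (add_root_edge (last (roots G)) u G) \<in> forest_span n p"
      by (rule graph_form_in_forest_span)
        (use G ne in \<open>simp_all add: add_root_edge_def length_remove1\<close>)
  qed
qed

lemma d_H_rootless:
  assumes "\<eta> \<in> forest_span 0 p"
  shows "d_H \<eta> = 0"
proof (rule linear_eq_on_forest_span[OF linear_d_H linear_zero assms])
  fix g assume "g \<in> forests 0 p"
  then obtain G where G: "aromatic_graph G" "g = abs_forest G" "roots G = []"
    by (auto elim: forests_cases)
  then show "d_H (Poly_Mapping.single g 1) = 0"
    by (simp add: d_H_def d_H_forest.abs_eq[OF graph_iso_refl[OF G(1)]])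
qed

lemma lie_derivative_Lagrangian:
  assumes \<gamma>: "\<gamma> \<in> forest_span 0 0"
  shows "lie_derivative \<tau> \<gamma> = contraction \<tau> (d_V \<gamma>)"
proof -
  have "contraction \<tau> \<gamma> = 0"
  proof (rule linear_eq_on_forest_span[OF linear_contraction linear_zero \<gamma>])
    fix g assume "g \<in> forests 0 0"
    then show "contraction \<tau> (Poly_Mapping.single g 1) = 0"
      by (simp add: contraction_def forests_def linear_extension_def)
  qed
  moreover have "d_total \<gamma> = d_V \<gamma>"
    unfolding d_total_def d_V_def
  proof (rule linear_eq_on_forest_span[OF linear_linear_extension linear_linear_extension \<gamma>])
    fix g assume g: "g \<in> forests 0 0"
    then have "d_H (Poly_Mapping.single g 1) = 0"
      by (intro d_H_rootless[where p = 0]) (auto simp: forest_span_def intro: span_base)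
    then show "linear_extension
        (\<lambda>\<gamma>. (- 1) ^ (num_roots \<gamma> + num_coverts \<gamma>) *\<^sub>R d_H (Poly_Mapping.single \<gamma> 1)
          + linear_extension (\<lambda>\<gamma>. wedge (covert_sum \<gamma>)) (Poly_Mapping.single \<gamma> 1))
        (Poly_Mapping.single g 1)
      = linear_extension (\<lambda>\<gamma>. wedge (covert_sum \<gamma>)) (Poly_Mapping.single g 1)"
      by simp
  qed
  moreover have "d_total 0 = 0" by (simp add: d_total_def linear_extension_def)
  ultimately show ?thesis by (simp add: lie_derivative_def)
qed

text \<open>
  Combinations of forests of different bidegrees have disjoint supports, so outside of
  bidegree \<open>(1, 0)\<close> of \<open>\<eta>\<close> the form \<open>d_H \<eta>\<close> is \<open>0\<close>.
\<close>

lemma d_H_Lagrangian_divergence: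
  assumes "\<eta> \<in> aromatic_forms n p" "d_H \<eta> \<in> forest_span 0 0"
  shows "d_H \<eta> \<in> divergences"
proof -
  have \<eta>: "\<eta> \<in> forest_span n p" using assms(1) aromatic_forms_subset by blast
  have zero: "0 \<in> divergences" by (rule subspace_0[OF subspace_divergences])
  show ?thesis
  proof (cases n)
    case 0
    then show ?thesis using d_H_rootless \<eta> zero by simp
  next
    case (Suc m)
    show ?thesis
    proof (cases "(m, p) = (0, 0)")
      case True
      then show ?thesis using \<eta> Suc by (simp add: divergences_def)
    next
      case False
      then have "d_H \<eta> = 0"
        using d_H_in_forest_span[of \<eta> m p] \<eta> Suc forest_span_disjoint[OF _ assms(2)] by blast
      then show ?thesis using zero by simp
    qed
  qed
qed

theorem theorem3p14:
  fixes \<gamma> \<tau> :: form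
  assumes "\<gamma> \<in> aromatic_forms 0 0" and "\<tau> \<in> aromatic_forms 1 0"
  shows "(divergence_symmetry \<tau> \<gamma> \<longleftrightarrow>
            (\<exists>\<eta>. generates_conservation_law \<tau> \<eta> (delta_V \<gamma>))) \<and>
         ((\<exists>\<eta>\<in>aromatic_forms 1 0. lie_derivative \<tau> \<gamma> = d_H \<eta>) \<longleftrightarrow>
            (\<exists>\<eta>'\<in>aromatic_forms 1 0. contraction \<tau> (delta_V \<gamma>) = d_H \<eta>'))"
proof -
  have \<gamma>: "\<gamma> \<in> forest_span 0 0" and \<tau>: "\<tau> \<in> forest_span 1 0"
    using assms aromatic_forms_le_1[of 0 0] aromatic_forms_le_1[of 1 0] by simp_all
  have L: "lie_derivative \<tau> \<gamma> = contraction \<tau> (d_V \<gamma>)"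
    by (rule lie_derivative_Lagrangian[OF \<gamma>])
  have parts: "lie_derivative \<tau> \<gamma> - contraction \<tau> (delta_V \<gamma>) \<in> divergences"
    unfolding L delta_V_def by (rule contraction_interior_euler[OF \<tau> d_V_in_forest_span[OF \<gamma>]])
  have iff: "lie_derivative \<tau> \<gamma> \<in> divergences \<longleftrightarrow> contraction \<tau> (delta_V \<gamma>) \<in> divergences"
    using subspace_add[OF subspace_divergences parts, of "contraction \<tau> (delta_V \<gamma>)"]
      subspace_diff[OF subspace_divergences _ parts, of "lie_derivative \<tau> \<gamma>"]
    by auto
  have div: "x \<in> divergences \<longleftrightarrow> (\<exists>\<eta>\<in>aromatic_forms 1 0. x = d_H \<eta>)" for x
    by (auto simp: divergences_def aromatic_forms_le_1)
  have "delta_V \<gamma> \<in> source_forms"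
    using d_V_in_forest_span[OF \<gamma>]
    by (simp add: source_forms_def delta_V_def aromatic_forms_le_1)
  then have gen: "(\<exists>\<eta>. generates_conservation_law \<tau> \<eta> (delta_V \<gamma>))
      \<longleftrightarrow> contraction \<tau> (delta_V \<gamma>) \<in> divergences"
    using assms(2) unfolding generates_conservation_law_def div by blast
  have "lie_derivative \<tau> \<gamma> \<in> forest_span 0 0"
    unfolding L by (rule contraction_in_forest_span[OF \<tau> d_V_in_forest_span[OF \<gamma>]])
  then have "divergence_symmetry \<tau> \<gamma> \<longleftrightarrow> lie_derivative \<tau> \<gamma> \<in> divergences"
    using assms(2) d_H_Lagrangian_divergence
    unfolding divergence_symmetry_def div by metis
  with gen iff show ?thesis unfolding div by blast
qed

end
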